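(* Let $\mathbf{X}\in\mathbb{R}^{n\times p}$ be a fixed matrix of full column rank with $2\le p<n$, let $\mathbf{y}\sim N(\mathbf{X}\boldsymbol{\beta}_0,\sigma^2\mathbf{I}_n)$ with $\mathbf{0}\ne\boldsymbol{\beta}_0\in\mathbb{R}^p$ and $\sigma>0$, let $k>p+1$, and let $\mathbf{S}$ be a $k\times n$ Gaussian sketching matrix independent of $\mathbf{y}$. Let $\mathbf{m}\in\mathbb{R}^p$ be a nonzero vector not in the same direction as $\boldsymbol{\beta}_0$, i.e. $$\frac{\mathbf{m}^{\mathsf T}\boldsymbol{\beta}_0}{\lVert\mathbf{m}\rVert\,\lVert\boldsymbol{\beta}_0\rVert}\ne1.$$ Then, under the joint randomness of $\mathbf{y}$ and $\mathbf{S}$, $$\mathbf{m}^{\mathsf T}\boldsymbol{\beta}_p\overset{d}{=}\frac{k-p-1}{R}\left[\mathbf{m}^{\mathsf T}\boldsymbol{\beta}_0+\sigma\left(1+\frac{U}{V}\right)^{1/2}\left\{\mathbf{m}^{\mathsf T}(\mathbf{X}^{\mathsf T}\mathbf{X})^{-1}\mathbf{m}\right\}^{1/2}Z\right],$$ where $R,Z,U,V$ are independent, $R\sim\chi^2_{k-p+1}$, $Z\sim N(0,1)$, $V\sim\chi^2_{k-p+2}$, and $U$ has a non-central $\chi^2_{p-1}$ distribution with non-centrality parameter $$\frac{1}{\sigma^2}\left\{\boldsymbol{\beta}_0^{\mathsf T}(\mathbf{X}^{\mathsf T}\mathbf{X})\boldsymbol{\beta}_0-\frac{(\mathbf{m}^{\mathsf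 T}\boldsymbol{\beta}_0)^2}{\mathbf{m}^{\mathsf T}(\mathbf{X}^{\mathsf T}\mathbf{X})^{-1}\mathbf{m}}\right\}.$$
   Context: A Gaussian sketching matrix $\mathbf{S}$ of size $k\times n$ has independent entries $\mathbf{S}_{ij}\sim N(0,1/k)$, and $\mathbf{X}_s=\mathbf{S}\mathbf{X}$. The (unbiased) partial sketch estimator is $\boldsymbol{\beta}_p=\gamma(\mathbf{X}_s^{\mathsf T}\mathbf{X}_s)^{-1}\mathbf{X}^{\mathsf T}\mathbf{y}$ with $\gamma=(k-p-1)/k$. The non-central $\chi^2_d$ distribution with non-centrality $\delta$ is the law of $\lVert\mathbf{w}\rVert^2$ for $\mathbf{w}\sim N(\boldsymbol{\mu},\mathbf{I}_d)$ with $\lVert\boldsymbol{\mu}\rVert^2=\delta$. *)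

theory Defs
  imports "HOL-Probability.Probability"
begin

(* The vector y has law N(mu, sigma^2 I): independent normal components. The last argument of
   normal_density is a standard deviation, here and below. *)
definition isotropic_normal ::
    "'a measure \<Rightarrow> ('a \<Rightarrow> real ^ 'n) \<Rightarrow> real ^ 'n \<Rightarrow> real \<Rightarrow> bool" where
  "isotropic_normal M y \<mu> \<sigma> \<longleftrightarrow>
     prob_space.indep_vars M (\<lambda>_. borel) (\<lambda>i \<omega>. y \<omega> $ i) UNIV \<and>
     (\<forall>i. distributed M lborel (\<lambda>\<omega>. y \<omega> $ i) (normal_density (\<mu> $ i) \<sigma>))"

definition gaussian_sketching_matrix ::
    "'a measure \<Rightarrow> ('a \<Rightarrow> real ^ 'n ^ 'k) \<Rightarrow> bool" where
  "gaussian_sketching_matrix M S \<longleftrightarrow>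
     prob_space.indep_vars M (\<lambda>_. borel) (\<lambda>(i, j) \<omega>. S \<omega> $ i $ j) UNIV \<and>
     (\<forall>i j. distributed M lborel (\<lambda>\<omega>. S \<omega> $ i $ j)
              (normal_density 0 (sqrt (1 / real CARD('k)))))"

(* Independence of Borel random elements of different types; the library's indep_var requires both
   to take values in the same type. *)
definition indep_random_elements ::
    "'a measure \<Rightarrow> ('a \<Rightarrow> 'b::topological_space) \<Rightarrow> ('a \<Rightarrow> 'c::topological_space) \<Rightarrow> bool" where
  "indep_random_elements M A B \<longleftrightarrow>
     A \<in> borel_measurable M \<and> B \<in> borel_measurable M \<and>
     prob_space.indep_set M {A -` E \<inter> space M | E. E \<in> sets borel}
                            {B -` E \<inter> space M | E. E \<in> sets borel}"

(* matrix_inv is an unspecified constant on singular matrices. For k >= p and X of full column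
   rank the sketched Gram matrix is singular only with probability zero. *)
definition partial_sketch_estimator ::
    "real ^ 'n ^ 'k \<Rightarrow> real ^ 'p ^ 'n \<Rightarrow> real ^ 'n \<Rightarrow> real ^ 'p" where
  "partial_sketch_estimator S X y =
     (let Xs = S ** X;
          \<gamma> = (real CARD('k) - real CARD('p) - 1) / real CARD('k)
      in \<gamma> *\<^sub>R (matrix_inv (transpose Xs ** Xs) *v (transpose X *v y)))"

(* The law of the squared norm of w, where w has law N(mu, I_d) *)
definition sq_norm_normal :: "nat \<Rightarrow> (nat \<Rightarrow> real) \<Rightarrow> real measure" where
  "sq_norm_normal d \<mu> =
     distr (\<Pi>\<^sub>M i\<in>{..<d}. density lborel (normal_density (\<mu> i) 1)) borel
           (\<lambda>w. \<Sum>i<d. (w i)\<^sup>2)"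

definition chi_square :: "nat \<Rightarrow> real measure" where
  "chi_square d = sq_norm_normal d (\<lambda>_. 0)"

definition is_noncentral_chi_square :: "nat \<Rightarrow> real \<Rightarrow> real measure \<Rightarrow> bool" where
  "is_noncentral_chi_square d \<delta> L \<longleftrightarrow>
     (\<exists>\<mu>. (\<Sum>i<d. (\<mu> i)\<^sup>2) = \<delta> \<and> L = sq_norm_normal d \<mu>)"

end

theory Submission
  imports Defs
begin

text \<open>
  Put E = range X and a = X (X^T X)^{-1} m, so that m = X^T a, and let P_E y denote the orthogonal
  projection of the response onto E. Write S = G / sqrt k with G standard Gaussian, choose orthonormal
  u1, u2 in E such that a = |a| u1 and P_E y lies in the span of u1 and u2, and let W be the image under
  G of the orthogonal complement of u1, u2 in E. With V the squared length of the component of G u2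
  orthogonal to W, T the coordinate of G u1 along that component, and R the squared length of the
  component of G u1 orthogonal to W and G u2, the normal equations give
  m^T beta_p = (k - p - 1) |a| (y.u1 - T / sqrt V * (y.u2)) / R.
  Rotation invariance shows that, given everything except G u1 and G u2, the variables T, R, V are
  independent with laws N(0,1), chi^2 with k - p + 1 and chi^2 with k - p + 2 degrees of freedom; this
  conditional law does not depend on the condition. Finally y.u1 is normal, (y.u2)^2 / sigma^2 is an
  independent noncentral chi^2 variable U, and the two independent normal variables combine to
  sqrt (1 + U / V) Z.
\<close>

section \<open>Standard Gaussian measures\<close>

text \<open>The response is integrated outermost, so u2 may depend on it without any measurability
  of that choice being at stake: for fixed y the integral over G sees y only through y.u1 and the
  length of P_E y - (y.u1) u1, which is y.u2. Conditional laws never appear. Laws are compared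
  through nonnegative integrals, and conditioning on everything except G u is replaced by
  overwriting G u with a fresh Gaussian vector, which preserves the law of G. The degrees of freedom
  are dimension counts: W has dimension p - 2 almost surely, so its complement in k-space has
  dimension k - p + 2, which gives V; removing the direction of the component of G u2 leaves k - p +
  1 for R. The factor 1 + U / V adds two variances: y.u1 contributes \<sigma> squared, and T times
  y.u2 / sqrt V contributes \<sigma> squared times U / V once U and V are held fixed.\<close>

abbreviation std_normal :: "real measure" where
  "std_normal \<equiv> density lborel std_normal_density"

text \<open>A density in the norm on an arbitrary Euclidean space reduces rotation invariance to
  that of Lebesgue measure, and one constant covers vectors, matrices and pairs of these.\<close>

definition std_gaussian :: "'e::euclidean_space measure" where
  "std_gaussian = density lborel (\<lambda>x. ennreal ((1 / sqrt (2 * pi)) ^ DIM('e) * exp (- (norm x)\<^sup>2 / 2)))"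

text \<open>Families rather than sets, because the coordinates along \<open>e\<close> have to become
  the components of a product measure over \<open>I\<close>.\<close>

definition orthonormal_on :: "'i set \<Rightarrow> ('i \<Rightarrow> 'e::real_inner) \<Rightarrow> bool" where
  "orthonormal_on I e \<longleftrightarrow> (\<forall>i\<in>I. \<forall>j\<in>I. e i \<bullet> e j = (if i = j then 1 else 0))"

section \<open>Rotation invariance and product form of the Gaussian measure\<close>

lemma nn_integral_lborel_plus:
  fixes g :: "'e::euclidean_space \<Rightarrow> ennreal"
  assumes [measurable]: "g \<in> borel_measurable borel"
  shows "(\<integral>\<^sup>+x. g (c + x) \<partial>lborel) = (\<integral>\<^sup>+x. g x \<partial>lborel)"
proof -
  have "(\<integral>\<^sup>+x. g x \<partial>lborel) = (\<integral>\<^sup>+x. g x \<partial>distr lborel borel ((+) c))"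
    by (simp add: lborel_distr_plus)
  also have "\<dots> = (\<integral>\<^sup>+x. g (c + x) \<partial>lborel)"
    by (rule nn_integral_distr) auto
  finally show ?thesis ..
qed

lemma borel_measurable_orthogonal_transformation:
  fixes f :: "'e::euclidean_space \<Rightarrow> 'e"
  assumes "orthogonal_transformation f"
  shows "f \<in> borel_measurable borel"
  using assms by (intro borel_measurable_continuous_onI linear_continuous_on)
    (simp add: linear_conv_bounded_linear orthogonal_transformation_def)

text \<open>Uniqueness of Haar measure by Fubini: compare both measures with the unit ball, which the
  transformation preserves.\<close>

lemma lborel_distr_orthogonal_transformation:
  fixes f :: "'e::euclidean_space \<Rightarrow> 'e"
  assumes f: "orthogonal_transformation f"
  shows "distr lborel borel f = lborel"
proof (rule measure_eqI)
  fix A :: "'e set"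
  assume "A \<in> sets (distr lborel borel f)"
  then have A[measurable]: "A \<in> sets borel" by simp
  have fm[measurable]: "f \<in> borel_measurable borel"
    by (rule borel_measurable_orthogonal_transformation[OF f])
  have lin: "linear f" using f by (simp add: orthogonal_transformation_def)
  define B where "B = ball (0::'e) 1"
  have [measurable]: "B \<in> sets borel" by (simp add: B_def)
  let ?B = B
  have Bf: "- f x \<in> ?B \<longleftrightarrow> x \<in> ?B" for x
    using f by (simp add: orthogonal_transformation_norm B_def)
  have surj: "\<exists>z. f z = y" for y
    using orthogonal_transformation_surj[OF f] by (metis surjD)
  let ?a = "\<lambda>x. indicator A x :: ennreal" and ?b = "\<lambda>x. indicator ?B x :: ennreal"
  have "emeasure lborel (f -` A) * emeasure lborel ?B
      = (\<integral>\<^sup>+x. ?a (f x) * (\<integral>\<^sup>+y. ?b y \<partial>lborel) \<partial>lborel)"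
  proof -
    have "emeasure lborel (f -` A) = (\<integral>\<^sup>+x. indicator (f -` A) x \<partial>lborel)"
      by (rule nn_integral_indicator[symmetric]) (use measurable_sets[OF fm A] in simp)
    also have "\<dots> = (\<integral>\<^sup>+x. ?a (f x) \<partial>lborel)" by (simp add: indicator_def)
    finally show ?thesis by (simp add: nn_integral_multc)
  qed
  also have "\<dots> = (\<integral>\<^sup>+x. (\<integral>\<^sup>+y. ?a (f x) * ?b (- f x + y) \<partial>lborel) \<partial>lborel)"
  proof (rule nn_integral_cong)
    fix x
    have "(\<integral>\<^sup>+y. ?a (f x) * ?b (- f x + y) \<partial>lborel) = (\<integral>\<^sup>+y. ?a (f x) * ?b y \<partial>lborel)"
      by (rule nn_integral_lborel_plus) measurable
    also have "\<dots> = ?a (f x) * (\<integral>\<^sup>+y. ?b y \<partial>lborel)"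
      by (rule nn_integral_cmult) measurable
    finally show "?a (f x) * (\<integral>\<^sup>+y. ?b y \<partial>lborel) = (\<integral>\<^sup>+y. ?a (f x) * ?b (- f x + y) \<partial>lborel)" ..
  qed
  also have "\<dots> = (\<integral>\<^sup>+y. (\<integral>\<^sup>+x. ?a (f x) * ?b (- f x + y) \<partial>lborel) \<partial>lborel)"
    by (rule lborel_pair.Fubini') measurable
  also have "\<dots> = (\<integral>\<^sup>+y. (\<integral>\<^sup>+x. ?a (y + f x) * ?b (- f x) \<partial>lborel) \<partial>lborel)"
  proof (rule nn_integral_cong)
    fix y
    \<comment> \<open>Shifting x by a preimage z of y moves y from the ball factor to the factor of
      A: by linearity f (z + x) = y + f x and - f (z + x) + y = - f x.\<close>
    obtain z where z: "f z = y" using surj by blast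
    have "(\<integral>\<^sup>+x. ?a (f x) * ?b (- f x + y) \<partial>lborel) = (\<integral>\<^sup>+x. ?a (f (z + x)) * ?b (- f (z + x) + y) \<partial>lborel)"
      by (rule nn_integral_lborel_plus[symmetric]) measurable
    then show "(\<integral>\<^sup>+x. ?a (f x) * ?b (- f x + y) \<partial>lborel) = (\<integral>\<^sup>+x. ?a (y + f x) * ?b (- f x) \<partial>lborel)"
      by (simp add: linear_add[OF lin] z)
  qed
  also have "\<dots> = (\<integral>\<^sup>+x. (\<integral>\<^sup>+y. ?a (f x + y) * ?b (- f x) \<partial>lborel) \<partial>lborel)"
    by (subst lborel_pair.Fubini') (simp_all add: add.commute)
  also have "\<dots> = (\<integral>\<^sup>+x. emeasure lborel A * ?b x \<partial>lborel)"
  proof (rule nn_integral_cong)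
    fix x
    have "(\<integral>\<^sup>+y. ?a (f x + y) * ?b (- f x) \<partial>lborel) = (\<integral>\<^sup>+y. ?a y * ?b (- f x) \<partial>lborel)"
      by (rule nn_integral_lborel_plus) measurable
    also have "\<dots> = emeasure lborel A * ?b (- f x)"
      by (simp add: nn_integral_multc)
    also have "\<dots> = emeasure lborel A * ?b x" using Bf[of x] by (simp add: indicator_def)
    finally show "(\<integral>\<^sup>+y. ?a (f x + y) * ?b (- f x) \<partial>lborel) = emeasure lborel A * ?b x" .
  qed
  also have "\<dots> = emeasure lborel A * emeasure lborel ?B"
    by (simp add: nn_integral_cmult)
  finally have "emeasure lborel (f -` A) * emeasure lborel ?B = emeasure lborel A * emeasure lborel ?B" .
  moreover have "emeasure lborel ?B \<noteq> 0"
    using open_not_negligible[of ?B] by (auto simp: B_def negligible_iff_null_sets null_sets_def emeasure_lborel_ball_finite)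
  moreover have "emeasure lborel ?B \<noteq> \<infinity>"
    using emeasure_lborel_ball_finite[of 0 1] by (simp add: less_top B_def)
  ultimately have "emeasure lborel (f -` A) = emeasure lborel A"
    by (auto simp: ennreal_mult_cancel_left mult.commute[of _ "emeasure lborel ?B"])
  then show "emeasure (distr lborel borel f) A = emeasure lborel A"
    by (simp add: emeasure_distr)
qed simp

lemma sets_std_gaussian[simp, measurable_cong]: "sets std_gaussian = sets borel"
  and space_std_gaussian[simp]: "space std_gaussian = UNIV"
  by (simp_all add: std_gaussian_def)

lemma std_gaussian_distr_orthogonal_transformation:
  fixes f :: "'e::euclidean_space \<Rightarrow> 'e"
  assumes f: "orthogonal_transformation f"
  shows "distr std_gaussian borel f = std_gaussian"
proof -
  let ?g = "\<lambda>x::'e. ennreal ((1 / sqrt (2 * pi)) ^ DIM('e) * exp (- (norm x)\<^sup>2 / 2))"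
  have fm[measurable]: "f \<in> borel_measurable borel"
    by (rule borel_measurable_orthogonal_transformation[OF f])
  have "distr (density lborel (?g \<circ> f)) borel f = density (distr lborel borel f) ?g"
    by (subst density_distr) (auto simp: comp_def)
  moreover have "?g \<circ> f = ?g" using f by (simp add: fun_eq_iff orthogonal_transformation_norm)
  ultimately show ?thesis
    by (simp add: std_gaussian_def lborel_distr_orthogonal_transformation[OF f])
qed

lemma prob_space_std_normal: "prob_space std_normal"
  by (rule prob_space_normal_density) simp

text \<open>The bridge between two descriptions: the density shows rotation invariance, the product
  shows independent coordinates. They agree because the squared norm is a sum over the basis, so the
  exponential factors.\<close>

lemma std_gaussian_eq_PiM:
  "(std_gaussian :: 'e::euclidean_space measure) =
     distr (\<Pi>\<^sub>M b\<in>Basis. std_normal) borel (\<lambda>f. \<Sum>b\<in>Basis. f b *\<^sub>R b)"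
proof -
  interpret L: product_sigma_finite "\<lambda>_::'e. lborel :: real measure"
    by (intro product_sigma_finite.intro sigma_finite_lborel)
  interpret P: product_prob_space "\<lambda>_::'e. std_normal"
    by (rule product_prob_spaceI) (rule prob_space_std_normal)
  let ?d = "\<lambda>f::'e \<Rightarrow> real. \<Prod>b\<in>Basis. ennreal (std_normal_density (f b))"
  let ?g = "\<lambda>x::'e. ennreal ((1 / sqrt (2 * pi)) ^ DIM('e) * exp (- (norm x)\<^sup>2 / 2))"
  let ?s = "\<lambda>f::'e \<Rightarrow> real. \<Sum>b\<in>Basis. f b *\<^sub>R b"
  have 1: "density (\<Pi>\<^sub>M b\<in>Basis. lborel) ?d = (\<Pi>\<^sub>M b\<in>(Basis::'e set). std_normal)"
  proof (rule P.PiM_eqI)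
    show "sets (density (\<Pi>\<^sub>M b\<in>(Basis::'e set). lborel) ?d) = sets (\<Pi>\<^sub>M b\<in>(Basis::'e set). std_normal)"
      by (simp only: sets_density) (rule sets_PiM_cong, simp_all)
    fix A :: "'e \<Rightarrow> real set" assume A: "\<And>b. b \<in> Basis \<Longrightarrow> A b \<in> sets std_normal"
    have [measurable]: "b \<in> Basis \<Longrightarrow> A b \<in> sets borel" for b using A[of b] by simp
    have *: "indicator (Pi\<^sub>E Basis A) f = (\<Prod>b\<in>Basis. indicator (A b) (f b) :: ennreal)"
      if "f \<in> space (\<Pi>\<^sub>M b\<in>(Basis::'e set). (lborel :: real measure))" for f
    proof (cases "\<forall>b\<in>Basis. f b \<in> A b")
      case True
      then show ?thesis using that by (auto simp: space_PiM PiE_def Pi_def)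
    next
      case False
      then obtain b where "b \<in> Basis" "f b \<notin> A b" by auto
      then show ?thesis by (auto simp: PiE_def Pi_def indicator_def)
    qed
    have "emeasure (density (\<Pi>\<^sub>M b\<in>Basis. lborel) ?d) (Pi\<^sub>E Basis A)
        = (\<integral>\<^sup>+f. ?d f * indicator (Pi\<^sub>E Basis A) f \<partial>(\<Pi>\<^sub>M b\<in>Basis. lborel))"
      by (rule emeasure_density) auto
    also have "\<dots> = (\<integral>\<^sup>+f. (\<Prod>b\<in>Basis. ennreal (std_normal_density (f b)) * indicator (A b) (f b)) \<partial>(\<Pi>\<^sub>M b\<in>Basis. lborel))"
      by (intro nn_integral_cong) (simp add: * prod.distrib)
    also have "\<dots> = (\<Prod>b\<in>Basis. \<integral>\<^sup>+x. ennreal (std_normal_density x) * indicator (A b) x \<partial>lborel)"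
      by (rule L.product_nn_integral_prod) auto
    also have "\<dots> = (\<Prod>b\<in>Basis. emeasure std_normal (A b))"
      by (intro prod.cong refl) (simp add: emeasure_density)
    finally show "emeasure (density (\<Pi>\<^sub>M b\<in>Basis. lborel) ?d) (Pi\<^sub>E Basis A) = (\<Prod>b\<in>Basis. emeasure std_normal (A b))" .
  qed simp
  have gd: "?g (?s f) = ?d f" for f
  proof -
    have "(norm (?s f))\<^sup>2 = (\<Sum>b\<in>Basis. (f b)\<^sup>2)"
      unfolding power2_norm_eq_inner by (subst euclidean_inner) (simp add: power2_eq_square)
    then have "?g (?s f) = ennreal (\<Prod>b\<in>(Basis::'e set). std_normal_density (f b))"
      by (simp add: std_normal_density_def prod_dividef power_divide exp_sum
          sum_negf[symmetric] sum_divide_distrib)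
    then show ?thesis by (simp add: prod_ennreal)
  qed
  have sm[measurable]: "?s \<in> measurable (\<Pi>\<^sub>M b\<in>Basis. lborel) borel" by measurable
  have "std_gaussian = density (distr (\<Pi>\<^sub>M b\<in>Basis. lborel) borel ?s) ?g"
    by (simp add: std_gaussian_def flip: lborel_eq)
  also have "\<dots> = distr (density (\<Pi>\<^sub>M b\<in>Basis. lborel) (\<lambda>f. ?g (?s f))) borel ?s"
    by (rule density_distr) auto
  also have "\<dots> = distr (\<Pi>\<^sub>M b\<in>Basis. std_normal) borel ?s"
    by (simp only: gd 1)
  finally show ?thesis .
qed

lemma prob_space_std_gaussian: "prob_space std_gaussian"
  unfolding std_gaussian_eq_PiM
  by (intro prob_space.prob_space_distr prob_space_PiM prob_space_std_normal) measurable

text \<open>Squared norms of the two components of a pair add, so the densities multiply. This lets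
  a single isometry of the product space act on two independent Gaussian elements at once.\<close>

lemma std_gaussian_prod:
  "(std_gaussian :: ('e::euclidean_space \<times> 'f::euclidean_space) measure) = std_gaussian \<Otimes>\<^sub>M std_gaussian"
proof -
  have sf: "sigma_finite_measure (density lborel (\<lambda>x::'f. ennreal ((1 / sqrt (2 * pi)) ^ DIM('f) * exp (- (norm x)\<^sup>2 / 2))))"
    using prob_space_std_gaussian[where 'a='f]
    by (simp add: std_gaussian_def prob_space_imp_sigma_finite)
  have "(\<lambda>x::'e\<times>'f. ennreal ((1 / sqrt (2 * pi)) ^ DIM('e \<times> 'f) * exp (- (norm x)\<^sup>2 / 2)))
    = (\<lambda>(x, y). ennreal ((1 / sqrt (2 * pi)) ^ DIM('e) * exp (- (norm x)\<^sup>2 / 2)) *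
        ennreal ((1 / sqrt (2 * pi)) ^ DIM('f) * exp (- (norm y)\<^sup>2 / 2)))"
    by (auto simp: fun_eq_iff norm_Pair power_add add_divide_distrib ennreal_mult[symmetric]
        exp_add[symmetric] mult_ac)
  then show ?thesis
    unfolding std_gaussian_def
    by (subst pair_measure_density[OF _ _ sigma_finite_lborel sf]) (simp_all add: lborel_prod)
qed


section \<open>Orthonormal families and Gaussian coordinates\<close>

lemma orthonormal_onD:
  "orthonormal_on I e \<Longrightarrow> i \<in> I \<Longrightarrow> j \<in> I \<Longrightarrow> e i \<bullet> e j = (if i = j then 1 else 0)"
  by (simp add: orthonormal_on_def)

lemma orthonormal_on_subset: "orthonormal_on I e \<Longrightarrow> J \<subseteq> I \<Longrightarrow> orthonormal_on J e"
  unfolding orthonormal_on_def by blast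

lemma orthonormal_on_inj: "orthonormal_on I e \<Longrightarrow> inj_on e I"
  by (rule inj_onI) (metis orthonormal_onD zero_neq_one)

text \<open>Complete the family by an orthonormal basis of its orthogonal complement. The result has
  as many elements as \<open>Basis\<close>, and the linear extension of any bijection between two
  orthonormal bases preserves inner products.\<close>

lemma orthonormal_on_orthogonal_transformation:
  fixes e :: "'i \<Rightarrow> 'e::euclidean_space"
  assumes e: "orthonormal_on I e"
  obtains f :: "'e \<Rightarrow> 'e" and \<beta> where "orthogonal_transformation f" "inj_on \<beta> I" "\<beta> ` I \<subseteq> Basis"
    "\<And>i. i \<in> I \<Longrightarrow> f (\<beta> i) = e i"
proof -
  let ?S = "e ` I"
  have orthS: "pairwise orthogonal ?S"
    using e by (auto simp: pairwise_def orthogonal_def orthonormal_on_def)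
  have nS: "norm x = 1" if "x \<in> ?S" for x
    using that e by (auto simp: norm_eq_1 orthonormal_on_def)
  have S0: "0 \<notin> ?S" using nS by force
  have indS: "independent ?S" by (rule pairwise_orthogonal_independent[OF orthS S0])
  then have finS: "finite ?S" and dimS: "dim (span ?S) = card ?S"
    by (auto simp: independent_bound dim_eq_card_independent)
  let ?C = "{y \<in> UNIV. \<forall>x\<in>span ?S. orthogonal x y}"
  have "subspace ?C" by (auto simp: subspace_def orthogonal_clauses orthogonal_def inner_right_distrib)
  then obtain B where B: "B \<subseteq> ?C" "pairwise orthogonal B" "\<And>x. x \<in> B \<Longrightarrow> norm x = 1"
      "independent B" "card B = dim ?C" "span B = ?C"
    by (rule orthonormal_basis_subspace) (rule that)
  have dimC: "dim ?C + dim (span ?S) = DIM('e)"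
    by (subst dim_subspace_orthogonal_to_vectors) auto
  have finB: "finite B" using B(4) by (simp add: independent_bound)
  have SB: "orthogonal x y" if "x \<in> ?S" "y \<in> B" for x y
    using that B(1) by (auto intro: span_base)
  have "?S \<inter> B = {}"
    using SB nS by (force simp: orthogonal_def)
  then have "card (?S \<union> B) = card (Basis :: 'e set)"
    using finS finB dimS dimC B(5) by (simp add: card_Un_disjoint)
  then obtain \<phi> where \<phi>: "bij_betw \<phi> (Basis::'e set) (?S \<union> B)"
    using finite_same_card_bij[of "Basis::'e set" "?S \<union> B"] finS finB by auto
  have \<phi>\<phi>: "\<phi> b \<bullet> \<phi> c = (if b = c then 1 else 0)" if "b \<in> Basis" "c \<in> Basis" for b c
  proof (cases "b = c")
    case True
    have "\<phi> b \<in> ?S \<union> B" using \<phi> that by (auto simp: bij_betw_def)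
    then have "norm (\<phi> b) = 1" using nS B(3) by blast
    then show ?thesis using True by (simp add: norm_eq_1)
  next
    case False
    have "\<phi> b \<in> ?S \<union> B" "\<phi> c \<in> ?S \<union> B" using \<phi> that by (auto simp: bij_betw_def)
    moreover have "\<phi> b \<noteq> \<phi> c" using \<phi> that False by (auto simp: bij_betw_def dest: inj_onD)
    ultimately have "orthogonal (\<phi> b) (\<phi> c)"
      using orthS B(2) by (elim UnE) (auto simp: pairwise_def intro: SB orthogonal_commute[THEN iffD1, OF SB])
    then show ?thesis using False by (simp add: orthogonal_def)
  qed
  define f where "f x = (\<Sum>b\<in>Basis. (x \<bullet> b) *\<^sub>R \<phi> b)" for x
  have "linear f"
    unfolding f_def
    by (rule linearI) (simp_all add: inner_add_left scaleR_add_left sum.distrib scaleR_sum_right)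
  moreover have "f x \<bullet> f y = x \<bullet> y" for x y
  proof -
    have "f x \<bullet> f y = (\<Sum>b\<in>Basis. \<Sum>c\<in>Basis. (x \<bullet> b) * (y \<bullet> c) * (\<phi> b \<bullet> \<phi> c))"
      unfolding f_def inner_sum_left inner_sum_right by (subst sum.swap) (simp add: mult_ac)
    also have "\<dots> = (\<Sum>b\<in>Basis. \<Sum>c\<in>Basis. if b = c then (x \<bullet> b) * (y \<bullet> c) else 0)"
      by (intro sum.cong refl) (simp add: \<phi>\<phi>)
    also have "\<dots> = x \<bullet> y" by (subst (2) euclidean_inner) simp
    finally show ?thesis .
  qed
  ultimately have orth: "orthogonal_transformation f"
    by (simp add: orthogonal_transformation_def)
  have f\<phi>: "f b = \<phi> b" if "b \<in> Basis" for b
  proof -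
    have "f b = (\<Sum>c\<in>Basis. if c = b then \<phi> b else 0)"
      unfolding f_def using that by (intro sum.cong refl) (simp add: inner_Basis)
    then show ?thesis using that by simp
  qed
  let ?\<beta> = "\<lambda>i. inv_into Basis \<phi> (e i)"
  have im: "e i \<in> \<phi> ` Basis" if "i \<in> I" for i
    using \<phi> that by (auto simp: bij_betw_def)
  show thesis
  proof (rule that[OF orth, of ?\<beta>])
    show "inj_on ?\<beta> I"
    proof (rule inj_onI)
      fix i j assume ij: "i \<in> I" "j \<in> I" and eq: "?\<beta> i = ?\<beta> j"
      have "e i = e j" using eq f_inv_into_f[OF im[OF ij(1)]] f_inv_into_f[OF im[OF ij(2)]] by metis
      then show "i = j" using inj_onD[OF orthonormal_on_inj[OF e]] ij by blast
    qed
    show "?\<beta> ` I \<subseteq> Basis" using im by (auto intro: inv_into_into)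
    show "f (?\<beta> i) = e i" if "i \<in> I" for i
      using f\<phi>[OF inv_into_into[OF im[OF that]]] f_inv_into_f[OF im[OF that]] by simp
  qed
qed

text \<open>An isometry carries some of the standard basis vectors to the given family. By rotation
  invariance it may be applied to x first, which leaves standard coordinates, and these are
  independent by the product form.\<close>

lemma std_gaussian_orthonormal_coordinates:
  fixes e :: "'i \<Rightarrow> 'e::euclidean_space"
  assumes e: "orthonormal_on I e"
  shows "distr std_gaussian (\<Pi>\<^sub>M i\<in>I. std_normal) (\<lambda>x. \<lambda>i\<in>I. x \<bullet> e i) = (\<Pi>\<^sub>M i\<in>I. std_normal)"
    (is "distr _ ?P _ = _")
proof -
  obtain f :: "'e \<Rightarrow> 'e" and \<beta> where f: "orthogonal_transformation f" and \<beta>: "inj_on \<beta> I" "\<beta> ` I \<subseteq> Basis"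
    and f\<beta>: "\<And>i. i \<in> I \<Longrightarrow> f (\<beta> i) = e i"
    by (rule orthonormal_on_orthogonal_transformation[OF e]) (rule that)
  let ?s = "\<lambda>f::'e \<Rightarrow> real. \<Sum>b\<in>Basis. f b *\<^sub>R b"
  have [measurable]: "f \<in> borel_measurable borel"
    by (rule borel_measurable_orthogonal_transformation[OF f])
  have coord: "(\<lambda>x. \<lambda>i\<in>I. x \<bullet> h i) \<in> measurable borel ?P" for h :: "'i \<Rightarrow> 'e"
    by (rule measurable_restrict) simp
  have "distr std_gaussian ?P (\<lambda>x. \<lambda>i\<in>I. x \<bullet> e i)
      = distr (distr std_gaussian borel f) ?P (\<lambda>x. \<lambda>i\<in>I. x \<bullet> e i)"
    by (simp add: std_gaussian_distr_orthogonal_transformation[OF f])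
  also have "\<dots> = distr std_gaussian ?P ((\<lambda>x. \<lambda>i\<in>I. x \<bullet> e i) \<circ> f)"
    by (rule distr_distr) (auto simp: coord)
  also have "(\<lambda>x. \<lambda>i\<in>I. x \<bullet> e i) \<circ> f = (\<lambda>x. \<lambda>i\<in>I. x \<bullet> \<beta> i)"
    using f by (auto simp: fun_eq_iff restrict_def f\<beta>[symmetric] orthogonal_transformation_def)
  also have "distr std_gaussian ?P (\<lambda>x. \<lambda>i\<in>I. x \<bullet> \<beta> i)
      = distr (\<Pi>\<^sub>M b\<in>Basis. std_normal) ?P ((\<lambda>x. \<lambda>i\<in>I. x \<bullet> \<beta> i) \<circ> ?s)"
    unfolding std_gaussian_eq_PiM by (rule distr_distr) (auto simp: coord)
  also have "\<dots> = distr (\<Pi>\<^sub>M b\<in>Basis. std_normal) ?P (\<lambda>\<omega>. \<lambda>i\<in>I. \<omega> (\<beta> i))"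
    using \<beta>(2) by (intro distr_cong refl) (auto simp: fun_eq_iff restrict_def image_subset_iff)
  also have "\<dots> = ?P"
    by (rule distr_PiM_reindex) (use \<beta> prob_space_std_normal in auto)
  finally show ?thesis .
qed

section \<open>Affine images, and identification of Gaussian laws\<close>

lemma distr_std_normal_affine:
  assumes "0 < \<sigma>"
  shows "distr std_normal borel (\<lambda>x. \<mu> + \<sigma> * x) = density lborel (normal_density \<mu> \<sigma>)"
proof -
  interpret prob_space std_normal by (rule prob_space_std_normal)
  have "distributed std_normal lborel (\<lambda>x. x) std_normal_density"
    by (auto simp: distributed_def intro: distr_id2)
  from normal_density_affine[OF this, of \<sigma> \<mu>] assms
  have "distr std_normal lborel (\<lambda>x. \<mu> + \<sigma> * x) = density lborel (normal_density \<mu> \<sigma>)"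
    by (auto simp: distributed_def)
  moreover have "distr std_normal lborel (\<lambda>x. \<mu> + \<sigma> * x) = distr std_normal borel (\<lambda>x. \<mu> + \<sigma> * x)"
    by (rule distr_cong) auto
  ultimately show ?thesis by simp
qed

lemma distr_PiM_std_normal_affine:
  fixes \<mu> :: "'i \<Rightarrow> real"
  assumes I: "finite I" and \<sigma>: "0 < \<sigma>"
  shows "distr (\<Pi>\<^sub>M i\<in>I. std_normal) (\<Pi>\<^sub>M i\<in>I. borel) (\<lambda>w. \<lambda>i\<in>I. \<mu> i + \<sigma> * w i) =
    (\<Pi>\<^sub>M i\<in>I. density lborel (normal_density (\<mu> i) \<sigma>))"
proof -
  interpret P: product_prob_space "\<lambda>_::'i. std_normal"
    by (rule product_prob_spaceI) (rule prob_space_std_normal)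
  interpret Q: product_prob_space "\<lambda>i::'i. density lborel (normal_density (\<mu> i) \<sigma>)"
    by (rule product_prob_spaceI) (rule prob_space_normal_density[OF \<sigma>])
  have m: "(\<lambda>w. \<lambda>i\<in>I. \<mu> i + \<sigma> * w i) \<in> measurable (\<Pi>\<^sub>M i\<in>I. std_normal) (\<Pi>\<^sub>M i\<in>I. borel)"
    by (rule measurable_restrict) measurable
  show ?thesis
  proof (rule Q.PiM_eqI[OF I])
    show "sets (distr (\<Pi>\<^sub>M i\<in>I. std_normal) (\<Pi>\<^sub>M i\<in>I. borel) (\<lambda>w. \<lambda>i\<in>I. \<mu> i + \<sigma> * w i)) =
      sets (\<Pi>\<^sub>M i\<in>I. density lborel (normal_density (\<mu> i) \<sigma>))"
      by (simp only: sets_distr) (rule sets_PiM_cong, simp_all)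
    fix A :: "'i \<Rightarrow> real set"
    assume A: "\<And>i. i \<in> I \<Longrightarrow> A i \<in> sets (density lborel (normal_density (\<mu> i) \<sigma>))"
    then have Ab[measurable]: "i \<in> I \<Longrightarrow> A i \<in> sets borel" for i by simp
    have vm: "(\<lambda>x. \<mu> i + \<sigma> * x) -` A i \<in> sets borel" if "i \<in> I" for i
      using measurable_sets[of "\<lambda>x. \<mu> i + \<sigma> * x" borel borel "A i"] that by simp
    have "emeasure (distr (\<Pi>\<^sub>M i\<in>I. std_normal) (\<Pi>\<^sub>M i\<in>I. borel) (\<lambda>w. \<lambda>i\<in>I. \<mu> i + \<sigma> * w i)) (Pi\<^sub>E I A)
       = emeasure (\<Pi>\<^sub>M i\<in>I. std_normal) (Pi\<^sub>E I (\<lambda>i. (\<lambda>x. \<mu> i + \<sigma> * x) -` A i))"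
      by (subst emeasure_distr[OF m])
        (auto simp: I space_PiM intro!: sets_PiM_I_finite arg_cong2[where f=emeasure])
    also have "\<dots> = (\<Prod>i\<in>I. emeasure std_normal ((\<lambda>x. \<mu> i + \<sigma> * x) -` A i))"
      by (rule P.emeasure_PiM) (use I vm in auto)
    also have "\<dots> = (\<Prod>i\<in>I. emeasure (density lborel (normal_density (\<mu> i) \<sigma>)) (A i))"
      by (intro prod.cong refl, subst distr_std_normal_affine[OF \<sigma>, symmetric],
          subst emeasure_distr) auto
    finally show "emeasure (distr (\<Pi>\<^sub>M i\<in>I. std_normal) (\<Pi>\<^sub>M i\<in>I. borel) (\<lambda>w. \<lambda>i\<in>I. \<mu> i + \<sigma> * w i)) (Pi\<^sub>E I A)
      = (\<Prod>i\<in>I. emeasure (density lborel (normal_density (\<mu> i) \<sigma>)) (A i))" .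
  qed
qed

text \<open>Serves both the response and the sketch, whose definitions speak of independent normal
  entries. Entries are coordinates in an orthonormal family, and \<open>expand\<close> rebuilds the
  vector from them, so the law of the coordinates determines the law of the vector.\<close>

lemma distr_eq_std_gaussian:
  fixes e :: "'i \<Rightarrow> 'e::euclidean_space" and Y :: "'a \<Rightarrow> 'e"
  assumes M: "prob_space M" and e: "orthonormal_on I e" and I: "finite I" "I \<noteq> {}"
    and expand: "\<And>x. (\<Sum>i\<in>I. (x \<bullet> e i) *\<^sub>R e i) = x"
    and indep: "prob_space.indep_vars M (\<lambda>_. borel) (\<lambda>i \<omega>. Y \<omega> \<bullet> e i) I"
    and dist: "\<And>i. i \<in> I \<Longrightarrow> distributed M lborel (\<lambda>\<omega>. Y \<omega> \<bullet> e i) (normal_density (\<mu> \<bullet> e i) \<sigma>)"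
    and \<sigma>: "0 < \<sigma>"
  shows "distr M borel Y = distr std_gaussian borel (\<lambda>x. \<mu> + \<sigma> *\<^sub>R x)"
proof -
  interpret prob_space M by fact
  let ?B = "\<Pi>\<^sub>M i\<in>I. (borel :: real measure)"
  let ?s = "\<lambda>w::'i \<Rightarrow> real. \<Sum>i\<in>I. w i *\<^sub>R e i"
  let ?a = "\<lambda>w. \<lambda>i\<in>I. \<mu> \<bullet> e i + \<sigma> * w i"
  have s[measurable]: "?s \<in> borel_measurable ?B" by measurable
  have Yi[measurable]: "i \<in> I \<Longrightarrow> (\<lambda>\<omega>. Y \<omega> \<bullet> e i) \<in> borel_measurable M" for i
    using dist[of i] by (simp add: distributed_def)
  have di: "distr M borel (\<lambda>\<omega>. Y \<omega> \<bullet> e i) = density lborel (normal_density (\<mu> \<bullet> e i) \<sigma>)" if "i \<in> I" for i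
    using dist[OF that] by (subst distr_cong[of M M borel lborel]) (auto simp: distributed_def)
  have Ym: "(\<lambda>\<omega>. \<lambda>i\<in>I. Y \<omega> \<bullet> e i) \<in> measurable M ?B"
    by (rule measurable_restrict) (rule Yi)
  have "distr M ?B (\<lambda>\<omega>. \<lambda>i\<in>I. Y \<omega> \<bullet> e i) = (\<Pi>\<^sub>M i\<in>I. distr M borel (\<lambda>\<omega>. Y \<omega> \<bullet> e i))"
    using indep by (subst (asm) indep_vars_iff_distr_eq_PiM'[OF I(2)]) auto
  also have "\<dots> = (\<Pi>\<^sub>M i\<in>I. density lborel (normal_density (\<mu> \<bullet> e i) \<sigma>))"
    by (rule PiM_cong) (auto simp: di)
  also have "\<dots> = distr (\<Pi>\<^sub>M i\<in>I. std_normal) ?B ?a"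
    by (rule distr_PiM_std_normal_affine[OF I(1) \<sigma>, symmetric])
  also have "\<dots> = distr (distr std_gaussian (\<Pi>\<^sub>M i\<in>I. std_normal) (\<lambda>x. \<lambda>i\<in>I. x \<bullet> e i)) ?B ?a"
    by (simp only: std_gaussian_orthonormal_coordinates[OF e])
  also have "\<dots> = distr std_gaussian ?B (?a \<circ> (\<lambda>x. \<lambda>i\<in>I. x \<bullet> e i))"
    by (rule distr_distr) (auto intro!: measurable_restrict)
  finally have *: "distr M ?B (\<lambda>\<omega>. \<lambda>i\<in>I. Y \<omega> \<bullet> e i) = distr std_gaussian ?B (?a \<circ> (\<lambda>x. \<lambda>i\<in>I. x \<bullet> e i))" .
  have "distr M borel Y = distr (distr M ?B (\<lambda>\<omega>. \<lambda>i\<in>I. Y \<omega> \<bullet> e i)) borel ?s"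
    by (subst distr_distr[OF s Ym]) (simp add: comp_def expand)
  also have "\<dots> = distr std_gaussian borel (?s \<circ> (?a \<circ> (\<lambda>x. \<lambda>i\<in>I. x \<bullet> e i)))"
    unfolding * by (rule distr_distr[OF s]) (auto intro!: measurable_restrict simp: comp_def)
  also have "?s \<circ> (?a \<circ> (\<lambda>x. \<lambda>i\<in>I. x \<bullet> e i)) = (\<lambda>x. \<mu> + \<sigma> *\<^sub>R x)"
    by (simp add: comp_def scaleR_add_left sum.distrib expand scaleR_sum_right[symmetric]
        scaleR_scaleR[symmetric] del: scaleR_scaleR)
  finally show ?thesis .
qed

section \<open>Chi-square laws as sums of squared Gaussian coordinates\<close>

lemma prob_space_sq_norm_normal: "prob_space (sq_norm_normal d \<mu>)"
  unfolding sq_norm_normal_def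
  by (intro prob_space.prob_space_distr prob_space_PiM prob_space_normal_density) auto

lemma sets_sq_norm_normal[simp, measurable_cong]: "sets (sq_norm_normal d \<mu>) = sets borel"
  and space_sq_norm_normal[simp]: "space (sq_norm_normal d \<mu>) = UNIV"
  by (simp_all add: sq_norm_normal_def)

lemma AE_sq_norm_normal_nonneg: "AE x in sq_norm_normal d \<mu>. 0 \<le> x"
  unfolding sq_norm_normal_def by (subst AE_distr_iff) (auto simp: sum_nonneg)

lemma sq_norm_normal_eq_distr:
  "sq_norm_normal d \<mu> = distr (\<Pi>\<^sub>M i\<in>{..<d}. std_normal) borel (\<lambda>w. \<Sum>i<d. (\<mu> i + w i)\<^sup>2)"
  unfolding sq_norm_normal_def
  by (subst distr_PiM_std_normal_affine[of "{..<d}" 1 \<mu>, OF finite_lessThan zero_less_one, symmetric],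
      subst distr_distr) (auto simp: comp_def intro!: measurable_restrict)

lemma std_gaussian_sum_squares:
  fixes q :: "nat \<Rightarrow> 'e::euclidean_space"
  assumes q: "orthonormal_on {..<d} q"
  shows "distr std_gaussian borel (\<lambda>x. \<Sum>i<d. (\<mu> i + x \<bullet> q i)\<^sup>2) = sq_norm_normal d \<mu>"
  unfolding sq_norm_normal_eq_distr
  by (subst std_gaussian_orthonormal_coordinates[OF q, symmetric], subst distr_distr) (auto simp: comp_def intro!: measurable_restrict)

text \<open>Used twice: with zero shifts for the pair (T, R) coming from one Gaussian column, and
  with nonzero shifts for the noise, where it makes the u1-coordinate independent of U. Index
  \<open>d\<close> is the coordinate kept apart from the squares.\<close>

lemma std_gaussian_coordinate_sum_squares:
  fixes q :: "nat \<Rightarrow> 'e::euclidean_space"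
  assumes q: "orthonormal_on {..<Suc d} q"
  shows "distr std_gaussian (borel \<Otimes>\<^sub>M borel) (\<lambda>x. (x \<bullet> q d, \<Sum>i<d. (\<mu> i + x \<bullet> q i)\<^sup>2)) =
    std_normal \<Otimes>\<^sub>M sq_norm_normal d \<mu>"
proof -
  let ?P = "\<lambda>n. \<Pi>\<^sub>M i\<in>{..<n}. std_normal"
  let ?g = "\<lambda>w. \<Sum>i<d. (\<mu> i + w i)\<^sup>2"
  have 1: "distr (std_normal \<Otimes>\<^sub>M ?P d) (?P (Suc d)) (\<lambda>(x, w). w(d := x)) = ?P (Suc d)"
    using distr_pair_PiM_eq_PiM[of "{..<d}" "\<lambda>_. std_normal" d]
    by (simp add: prob_space_std_normal lessThan_Suc)
  have upd: "(\<lambda>(x, w). w(d := x)) \<in> measurable (std_normal \<Otimes>\<^sub>M ?P d) (?P (Suc d))"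
    unfolding lessThan_Suc split_beta
    by (rule measurable_fun_upd[where J="{..<d}"]) auto
  have "distr std_gaussian (borel \<Otimes>\<^sub>M borel) (\<lambda>x. (x \<bullet> q d, \<Sum>i<d. (\<mu> i + x \<bullet> q i)\<^sup>2))
      = distr (?P (Suc d)) (borel \<Otimes>\<^sub>M borel) (\<lambda>w. (w d, ?g w))"
    by (subst std_gaussian_orthonormal_coordinates[OF q, symmetric], subst distr_distr) (auto simp: comp_def intro!: measurable_restrict)
  also have "\<dots> = distr (std_normal \<Otimes>\<^sub>M ?P d) (borel \<Otimes>\<^sub>M borel) (\<lambda>(x, w). (x, ?g w))"
    by (subst 1[symmetric], subst distr_distr[OF _ upd]) (auto simp: comp_def split_beta intro!: distr_cong)
  also have "\<dots> = distr std_normal borel (\<lambda>x. x) \<Otimes>\<^sub>M distr (?P d) borel ?g"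
  proof (rule pair_measure_distr[symmetric])
    show "sigma_finite_measure (distr (?P d) borel ?g)"
      using prob_space_sq_norm_normal[of d \<mu>]
      by (simp add: sq_norm_normal_eq_distr prob_space_imp_sigma_finite)
  qed auto
  also have "\<dots> = std_normal \<Otimes>\<^sub>M sq_norm_normal d \<mu>"
    by (simp add: sq_norm_normal_eq_distr distr_id2)
  finally show ?thesis .
qed

lemma std_gaussian_unit_coordinate:
  fixes v :: "'e::euclidean_space"
  assumes "norm v = 1"
  shows "distr std_gaussian borel (\<lambda>x. x \<bullet> v) = std_normal"
proof -
  have e: "orthonormal_on {()} (\<lambda>_. v)" using assms by (simp add: orthonormal_on_def norm_eq_1)
  have "distr (\<Pi>\<^sub>M i\<in>{()}. std_normal) std_normal (\<lambda>w. w ()) = std_normal"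
    by (rule distr_PiM_component) (auto simp: prob_space_std_normal)
  then have "std_normal = distr (distr std_gaussian (\<Pi>\<^sub>M i\<in>{()}. std_normal) (\<lambda>x. \<lambda>i\<in>{()}. x \<bullet> v)) std_normal (\<lambda>w. w ())"
    by (simp add: std_gaussian_orthonormal_coordinates[OF e])
  also have "\<dots> = distr std_gaussian std_normal (\<lambda>x. x \<bullet> v)"
    by (subst distr_distr) (auto simp: comp_def intro!: measurable_restrict)
  also have "\<dots> = distr std_gaussian borel (\<lambda>x. x \<bullet> v)"
    by (rule distr_cong) auto
  finally show ?thesis ..
qed

lemma std_gaussian_real: "std_gaussian = std_normal"
  by (auto simp: std_gaussian_def std_normal_density_def intro!: density_cong)

text \<open>The pair (z, t) is a standard Gaussian vector in the plane, and z - s t is its inner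
  product with (1, -s). Dividing that vector by its length gives the unit vector \<open>v\<close>,
  along which the coordinate is standard normal.\<close>

lemma nn_integral_std_normal_combine:
  assumes [measurable]: "f \<in> borel_measurable borel"
  shows "(\<integral>\<^sup>+z. \<integral>\<^sup>+t. f (z - s * t) \<partial>std_normal \<partial>std_normal) =
    (\<integral>\<^sup>+z. f (sqrt (1 + s\<^sup>2) * z) \<partial>std_normal)"
proof -
  interpret prob_space std_normal by (rule prob_space_std_normal)
  interpret P: pair_sigma_finite std_normal std_normal ..
  let ?r = "sqrt (1 + s\<^sup>2)"
  have r: "?r > 0" by (simp add: add_pos_nonneg)
  define v where "v = (1 / ?r, - s / ?r)"
  have "norm v = 1"
    using r by (simp add: v_def norm_Pair power_divide add_divide_distrib[symmetric])
  have "(\<integral>\<^sup>+z. f (?r * z) \<partial>std_normal) = (\<integral>\<^sup>+x. f (?r * (x \<bullet> v)) \<partial>std_gaussian)"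
    by (subst std_gaussian_unit_coordinate[OF \<open>norm v = 1\<close>, symmetric], rule nn_integral_distr) auto
  also have "(\<lambda>x. f (?r * (x \<bullet> v))) = (\<lambda>(z, t). f (z - s * t))"
    using r by (auto simp: fun_eq_iff v_def field_simps intro!: arg_cong[where f=f])
  also have "(\<integral>\<^sup>+x. (case x of (z, t) \<Rightarrow> f (z - s * t)) \<partial>std_gaussian)
      = (\<integral>\<^sup>+x. (case x of (z, t) \<Rightarrow> f (z - s * t)) \<partial>(std_normal \<Otimes>\<^sub>M std_normal))"
    by (simp add: std_gaussian_prod std_gaussian_real)
  also have "\<dots> = (\<integral>\<^sup>+z. \<integral>\<^sup>+t. f (z - s * t) \<partial>std_normal \<partial>std_normal)"
    by (subst nn_integral_fst[symmetric]) simp_all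
  finally show ?thesis ..
qed


section \<open>Gaussian matrices\<close>

lemma orthonormal_basis_family:
  fixes W :: "'e::euclidean_space set"
  assumes "subspace W"
  obtains q where "orthonormal_on {..<dim W} q" "\<And>i. i < dim W \<Longrightarrow> q i \<in> W"
    "\<And>x. x \<in> W \<Longrightarrow> (\<Sum>i<dim W. (x \<bullet> q i) *\<^sub>R q i) = x"
proof -
  obtain B where B: "B \<subseteq> W" "pairwise orthogonal B" "\<And>x. x \<in> B \<Longrightarrow> norm x = 1"
      "independent B" "card B = dim W" "span B = W"
    by (rule orthonormal_basis_subspace[OF assms]) (rule that)
  have fin: "finite B" using B(4) by (simp add: independent_bound)
  obtain q where q: "bij_betw q {..<dim W} B"
    using ex_bij_betw_nat_finite[OF fin] B(5) by (auto simp: atLeast0LessThan)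
  show thesis
  proof (rule that[of q])
    show "orthonormal_on {..<dim W} q"
      unfolding orthonormal_on_def
    proof (intro ballI)
      fix i j assume ij: "i \<in> {..<dim W}" "j \<in> {..<dim W}"
      then have "q i \<in> B" "q j \<in> B" "q i = q j \<longleftrightarrow> i = j"
        using q by (auto simp: bij_betw_def dest: inj_onD)
      then show "q i \<bullet> q j = (if i = j then 1 else 0)"
        using B(2,3) by (auto simp: pairwise_def orthogonal_def norm_eq_1)
    qed
    show "q i \<in> W" if "i < dim W" for i
      using q B(1) that by (auto simp: bij_betw_def)
    show "(\<Sum>i<dim W. (x \<bullet> q i) *\<^sub>R q i) = x" if "x \<in> W" for x
      using orthonormal_basis_expand[OF B(2,3) _ fin, of x] that B(6)
      by (subst sum.reindex_bij_betw[OF q, of "\<lambda>b. (x \<bullet> b) *\<^sub>R b"]) auto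
  qed
qed

text \<open>A basis of the complement of v in W with v appended at the end. Having the prescribed
  vector last makes a sum over indices below \<open>d\<close> a sum over the directions orthogonal
  to it.\<close>

lemma orthonormal_basis_family_last:
  fixes W :: "'e::euclidean_space set"
  assumes W: "subspace W" and v: "v \<in> W" "norm v = 1"
  obtains q d where "dim W = Suc d" "q d = v" "orthonormal_on {..<Suc d} q"
    "\<And>i. i < Suc d \<Longrightarrow> q i \<in> W"
    "\<And>x. x \<in> W \<Longrightarrow> (\<Sum>i<Suc d. (x \<bullet> q i) *\<^sub>R q i) = x"
proof -
  let ?W = "{x \<in> W. \<forall>w\<in>span {v}. orthogonal w x}"
  have sub: "subspace ?W"
    using W by (auto simp: subspace_def orthogonal_def inner_add_right)
  have "dim ?W + dim (span {v}) = dim W"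
    by (rule dim_subspace_orthogonal_to_vectors) (use W v span_minimal[of "{v}" W] in auto)
  moreover have "dim (span {v}) = 1"
    using v(2) by (cases "v = 0") auto
  ultimately have dim: "dim W = Suc (dim ?W)" by simp
  obtain q where q: "orthonormal_on {..<dim ?W} q" "\<And>i. i < dim ?W \<Longrightarrow> q i \<in> ?W"
    "\<And>x. x \<in> ?W \<Longrightarrow> (\<Sum>i<dim ?W. (x \<bullet> q i) *\<^sub>R q i) = x"
    by (rule orthonormal_basis_family[OF sub]) (rule that)
  have vq: "v \<bullet> q i = 0" if "i < dim ?W" for i
    using q(2)[OF that] by (auto simp: orthogonal_def intro: span_base)
  have vv: "v \<bullet> v = 1" using v by (simp add: norm_eq_1)
  show thesis
  proof (rule that[of "dim ?W" "q(dim ?W := v)"])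
    show "orthonormal_on {..<Suc (dim ?W)} (q(dim ?W := v))"
      using q(1) by (auto simp: orthonormal_on_def less_Suc_eq vq vv inner_commute)
    show "(q(dim ?W := v)) i \<in> W" if "i < Suc (dim ?W)" for i
      using that q(2)[of i] v by (auto simp: less_Suc_eq)
    fix x assume x: "x \<in> W"
    let ?x = "x - (x \<bullet> v) *\<^sub>R v"
    have "?x \<in> ?W"
      using W x v vv by (auto simp: subspace_diff subspace_scale orthogonal_def span_singleton
          inner_diff_right inner_commute)
    then have "(\<Sum>i<dim ?W. (?x \<bullet> q i) *\<^sub>R q i) = ?x" by (rule q(3))
    then have "(\<Sum>i<dim ?W. (x \<bullet> q i) *\<^sub>R q i) = ?x"
      by (simp add: inner_diff_left vq)
    then show "(\<Sum>i<Suc (dim ?W). (x \<bullet> (q(dim ?W := v)) i) *\<^sub>R (q(dim ?W := v)) i) = x"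
      by simp
  qed (use dim in auto)
qed

text \<open>Split x into a part in W and a part orthogonal to W. The sum does not see the first part
  and reproduces the second, so the difference is the projection of x onto W.\<close>

lemma diff_orthogonal_expansion_in_subspace:
  fixes W :: "'e::euclidean_space set"
  assumes W: "subspace W"
    and expand: "\<And>x. (\<And>w. w \<in> W \<Longrightarrow> orthogonal w x) \<Longrightarrow> (\<Sum>i\<in>I. (x \<bullet> q i) *\<^sub>R q i) = x"
    and q: "\<And>i w. i \<in> I \<Longrightarrow> w \<in> W \<Longrightarrow> orthogonal w (q i)"
  shows "x - (\<Sum>i\<in>I. (x \<bullet> q i) *\<^sub>R q i) \<in> W"
proof -
  obtain y z where yz: "y \<in> span W" "\<And>w. w \<in> span W \<Longrightarrow> orthogonal z w" "x = y + z"
    by (rule orthogonal_subspace_decomp_exists[of W x]) (rule that)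
  have sW: "span W = W" using W by (simp add: span_eq_iff)
  have "(\<Sum>i\<in>I. (x \<bullet> q i) *\<^sub>R q i) = (\<Sum>i\<in>I. (z \<bullet> q i) *\<^sub>R q i)"
    using q yz(1) by (intro sum.cong refl) (simp add: yz(3) inner_add_left orthogonal_def sW)
  also have "\<dots> = z" using yz(2) by (intro expand) (simp add: sW orthogonal_commute)
  finally show ?thesis using yz by (simp add: sW)
qed

section \<open>Null sets and resampling for Gaussian matrices\<close>

lemma AE_std_gaussian_not_in_subspace:
  fixes W :: "'e::euclidean_space set"
  assumes W: "subspace W" "dim W < DIM('e)"
  shows "AE x in std_gaussian. x \<notin> W"
proof -
  have [measurable]: "W \<in> sets borel" using W by (intro borel_closed closed_subspace)
  have "W \<in> null_sets lebesgue"
    using negligible_lowdim[OF W(2)] by (simp add: negligible_iff_null_sets)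
  then have "W \<in> null_sets lborel"
    by (subst (asm) null_sets_completion_iff) auto
  then have "AE x in lborel. x \<notin> W" by (rule AE_not_in)
  then show ?thesis unfolding std_gaussian_def by (subst AE_density) (auto elim: AE_mp)
qed

text \<open>For a unit vector u, the matrix that maps u to g and agrees with G on the complement of u.\<close>

definition resample :: "real ^ 'n \<Rightarrow> real ^ 'n ^ 'k \<Rightarrow> real ^ 'k \<Rightarrow> real ^ 'n ^ 'k" where
  "resample u G g = (\<chi> l. G $ l + (g $ l - G $ l \<bullet> u) *\<^sub>R u)"

lemma resample_mult_vec:
  "resample u G g *v w = G *v w + (u \<bullet> w) *\<^sub>R (g - G *v u)"
  by (simp add: vec_eq_iff resample_def matrix_vector_mul_component inner_add_left algebra_simps)

lemma borel_measurable_resample: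
  "(\<lambda>(G, g). resample u G g) \<in> borel_measurable (borel :: ((real ^ 'n ^ 'k) \<times> (real ^ 'k)) measure)"
  unfolding resample_def split_beta
  by (intro borel_measurable_continuous_onI continuous_intros)

text \<open>This stands in for conditional distributions: G u is independent of the action of G on
  the complement of u, so a fresh Gaussian vector may take its place, and the inner integral
  averages over G u with everything else held fixed.\<close>

lemma nn_integral_std_gaussian_resample:
  fixes u :: "real ^ 'n" and h :: "real ^ 'n ^ 'k \<Rightarrow> ennreal"
  assumes u: "norm u = 1" and h[measurable]: "h \<in> borel_measurable borel"
  shows "(\<integral>\<^sup>+G. h G \<partial>std_gaussian) = (\<integral>\<^sup>+G. \<integral>\<^sup>+g. h (resample u G g) \<partial>std_gaussian \<partial>std_gaussian)"
proof -
  let ?\<gamma> = "std_gaussian :: (real ^ 'n ^ 'k) measure" and ?\<delta> = "std_gaussian :: (real ^ 'k) measure"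
  interpret D: prob_space ?\<delta> by (rule prob_space_std_gaussian)
  \<comment> \<open>This map exchanges G u with g, so it is an isometry of the product space.\<close>
  define \<Phi> where "\<Phi> = (\<lambda>(G :: real ^ 'n ^ 'k, g :: real ^ 'k). (resample u G g, G *v u))"
  have uu: "u \<bullet> u = 1" using u by (simp add: norm_eq_1)
  have lin: "linear \<Phi>"
    unfolding \<Phi>_def
    by (rule linearI)
      (auto simp: vec_eq_iff resample_def matrix_vector_mul_component algebra_simps inner_add_left split_beta)
  have "norm (\<Phi> v) = norm v" for v
  proof -
    obtain G g where v: "v = (G, g)" by (cases v)
    \<comment> \<open>Row by row, the part of \<open>G $ l\<close> orthogonal to u is kept while its
      u-coordinate trades places with \<open>g $ l\<close>, so the total sum of squares is
      unchanged.\<close>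
    have row: "(G $ l + (g $ l - G $ l \<bullet> u) *\<^sub>R u) \<bullet> (G $ l + (g $ l - G $ l \<bullet> u) *\<^sub>R u)
        + (G $ l \<bullet> u) * (G $ l \<bullet> u) = G $ l \<bullet> G $ l + g $ l * g $ l" for l
      by (simp add: inner_add_left inner_add_right uu inner_commute algebra_simps)
    have "\<Phi> v \<bullet> \<Phi> v = v \<bullet> v"
      by (simp add: v \<Phi>_def inner_vec_def[where 'a="real^'n"] inner_vec_def[where 'a=real and 'b='k]
          resample_def matrix_vector_mul_component sum.distrib[symmetric] row)
    then show ?thesis by (simp add: norm_eq_sqrt_inner)
  qed
  then have orth: "orthogonal_transformation \<Phi>"
    using lin by (simp add: orthogonal_transformation)
  have [measurable]: "\<Phi> \<in> borel_measurable borel"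
    by (rule borel_measurable_orthogonal_transformation[OF orth])
  have hm: "(\<lambda>v :: ((real ^ 'n ^ 'k) \<times> (real ^ 'k)). h (fst v)) \<in> borel_measurable borel"
    by (simp add: borel_prod[symmetric])
  have "(\<integral>\<^sup>+G. h G \<partial>?\<gamma>) = (\<integral>\<^sup>+G. \<integral>\<^sup>+g. h (fst (G, g)) \<partial>?\<delta> \<partial>?\<gamma>)"
    by (simp add: D.emeasure_space_1[simplified])
  also have "\<dots> = (\<integral>\<^sup>+v. h (fst v) \<partial>(std_gaussian :: ((real ^ 'n ^ 'k) \<times> (real ^ 'k)) measure))"
    unfolding std_gaussian_prod by (rule D.nn_integral_fst) measurable
  also have "\<dots> = (\<integral>\<^sup>+v. h (fst v) \<partial>distr std_gaussian borel \<Phi>)"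
    by (simp add: std_gaussian_distr_orthogonal_transformation[OF orth])
  also have "\<dots> = (\<integral>\<^sup>+v. h (fst (\<Phi> v)) \<partial>std_gaussian)"
    by (rule nn_integral_distr) (use hm in auto)
  also have "\<dots> = (\<integral>\<^sup>+G. \<integral>\<^sup>+g. h (fst (\<Phi> (G, g))) \<partial>?\<delta> \<partial>?\<gamma>)"
    unfolding std_gaussian_prod
    by (rule D.nn_integral_fst[symmetric])
      (use measurable_compose[OF \<open>\<Phi> \<in> borel_measurable borel\<close> hm] in \<open>simp add: borel_prod[symmetric] cong: measurable_cong_sets\<close>)
  finally show ?thesis by (simp add: \<Phi>_def)
qed

text \<open>If G w = 0 and w has a nonzero coordinate along \<open>q i\<close>, then the image of
  \<open>q i\<close> lies in the image under G of the complement of \<open>q i\<close> in E. That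
  image has dimension below k, and a resampled value of G at \<open>q i\<close> avoids it almost
  surely.\<close>

lemma AE_std_gaussian_inj_on_subspace:
  fixes E :: "(real ^ 'n) set"
  assumes E: "subspace E" "dim E \<le> CARD('k)"
  shows "AE G in (std_gaussian :: (real ^ 'n ^ 'k) measure). \<forall>w\<in>E. G *v w = 0 \<longrightarrow> w = 0"
proof -
  obtain q where q: "orthonormal_on {..<dim E} q" "\<And>i. i < dim E \<Longrightarrow> q i \<in> E"
    "\<And>x. x \<in> E \<Longrightarrow> (\<Sum>i<dim E. (x \<bullet> q i) *\<^sub>R q i) = x"
    by (rule orthonormal_basis_family[OF E(1)]) (rule that)
  \<comment> \<open>The bound away from zero makes these sets compact. Every nonzero w in E, once
    normalised, lies in some \<open>K i N\<close>, so countably many of them detect a nontrivial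
    kernel on E.\<close>
  define K where "K i N = {w \<in> E. norm w \<le> 1 \<and> 1 / real (Suc N) \<le> \<bar>w \<bullet> q i\<bar>}" for i N
  \<comment> \<open>Projections of closed sets along a compact set are closed, which settles measurability.\<close>
  define A :: "nat \<Rightarrow> nat \<Rightarrow> (real ^ 'n ^ 'k) set"
    where "A i N = {G. \<exists>w. w \<in> K i N \<and> (w, G) \<in> {(w, G). G *v w = 0}}" for i N
  have Kc: "compact (K i N)" for i N
  proof -
    have "K i N = E \<inter> cball 0 1 \<inter> {w. 1 / real (Suc N) \<le> \<bar>w \<bullet> q i\<bar>}"
      by (auto simp: K_def)
    moreover have "closed {w. 1 / real (Suc N) \<le> \<bar>w \<bullet> q i\<bar>}"
      by (intro closed_Collect_le continuous_intros)
    ultimately show ?thesis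
      using closed_subspace[OF E(1)] by (metis closed_Int_compact compact_Int_closed compact_cball)
  qed
  have T: "closed {(w, G). (G :: real ^ 'n ^ 'k) *v w = 0}"
  proof -
    have "{(w, G). (G :: real ^ 'n ^ 'k) *v w = 0} = {v. (\<chi> l. \<Sum>j\<in>UNIV. snd v $ l $ j * fst v $ j) = 0}"
      by (auto simp: matrix_vector_mult_def)
    also have "closed \<dots>"
      by (intro closed_Collect_eq continuous_intros)
    finally show ?thesis .
  qed
  have Ac: "closed (A i N)" for i N
    unfolding A_def by (rule closed_compact_projection[OF Kc T])
  have "AE G in std_gaussian. G \<notin> A i N" if i: "i < dim E" for i N
  proof -
    have [measurable]: "A i N \<in> sets borel" using Ac by (rule borel_closed)
    have nq: "norm (q i) = 1" using q(1) i by (auto simp: orthonormal_on_def norm_eq_1)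
    have "(\<integral>\<^sup>+g. indicator (A i N) (resample (q i) G g) \<partial>std_gaussian) = (0::ennreal)" for G
    proof -
      let ?E = "{x \<in> E. \<forall>w\<in>span {q i}. orthogonal w x}"
      let ?W = "(*v) G ` ?E"
      have sub: "subspace ?E"
        using E(1) by (auto simp: subspace_def orthogonal_def inner_add_right)
      have "dim ?E + dim (span {q i}) = dim E"
        by (rule dim_subspace_orthogonal_to_vectors) (use E q(2)[OF i] span_minimal[of "{q i}" E] in auto)
      moreover have "dim (span {q i}) = 1"
        using nq by (cases "q i = 0") auto
      ultimately have "dim ?W < CARD('k)"
        using dim_image_le[of "(*v) G" ?E] E(2) by simp
      then have "AE g in std_gaussian. g \<notin> ?W"
        using linear_subspace_image[OF matrix_vector_mul_linear sub, of G]
        by (intro AE_std_gaussian_not_in_subspace) auto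
      moreover have "resample (q i) G g \<notin> A i N" if g: "g \<notin> ?W" for g
      proof
        assume "resample (q i) G g \<in> A i N"
        then obtain w where w: "w \<in> K i N" "resample (q i) G g *v w = 0" by (auto simp: A_def)
        define c where "c = q i \<bullet> w"
        have "0 < 1 / real (Suc N)" by simp
        also have "\<dots> \<le> \<bar>c\<bar>" using w(1) by (simp add: K_def c_def inner_commute)
        finally have c: "c \<noteq> 0" by auto
        \<comment> \<open>The vector w / c has \<open>q i\<close>-coordinate 1, so \<open>?x\<close>
          is orthogonal to \<open>q i\<close>. That the resampled matrix kills w says exactly that g
          is the image of \<open>?x\<close> under G.\<close>
        let ?x = "q i - (1 / c) *\<^sub>R w"
        have "?x \<in> ?E"
          using w(1) E(1) q(2)[OF i] nq c
          by (auto simp: K_def subspace_diff subspace_scale orthogonal_def span_singleton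
              inner_diff_right norm_eq_1 c_def[symmetric])
        moreover have "g = G *v ?x"
        proof -
          have "G *v w + c *\<^sub>R (g - G *v q i) = 0"
            using w(2) by (simp add: resample_mult_vec c_def)
          then have "(1 / c) *\<^sub>R (G *v w + c *\<^sub>R (g - G *v q i)) = 0" by simp
          then show ?thesis
            using c by (simp add: scaleR_add_right matrix_vector_mult_diff_distrib
                matrix_vector_mult_scaleR algebra_simps)
        qed
        ultimately show False using g by blast
      qed
      ultimately have "AE g in std_gaussian. indicator (A i N) (resample (q i) G g) = (0::ennreal)"
        by (auto elim!: AE_mp)
      then show ?thesis by (subst nn_integral_cong_AE) auto
    qed
    then have "emeasure std_gaussian (A i N) = 0"
      using nn_integral_std_gaussian_resample[OF nq, of "indicator (A i N) :: real ^ 'n ^ 'k \<Rightarrow> ennreal"]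
      by simp
    then have "A i N \<in> null_sets std_gaussian" by (auto simp: null_sets_def)
    then show ?thesis by (rule AE_not_in)
  qed
  then have "AE G in std_gaussian. \<forall>i\<in>{..<dim E}. \<forall>N\<in>UNIV. G \<notin> A i N"
    by (intro AE_ball_countable[THEN iffD2] ballI) auto
  then show ?thesis
  proof (rule AE_mp, intro AE_I2 impI ballI)
    fix G :: "real ^ 'n ^ 'k" and w
    assume G: "\<forall>i\<in>{..<dim E}. \<forall>N\<in>UNIV. G \<notin> A i N" and w: "w \<in> E" "G *v w = 0"
    show "w = 0"
    proof (rule ccontr)
      assume "w \<noteq> 0"
      then obtain i where i: "i < dim E" "w \<bullet> q i \<noteq> 0"
        using q(3)[OF w(1)] by (metis (no_types, lifting) lessThan_iff scale_eq_0_iff sum.neutral)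
      let ?w = "(1 / norm w) *\<^sub>R w"
      have "0 < \<bar>?w \<bullet> q i\<bar>" using i \<open>w \<noteq> 0\<close> by simp
      then obtain N where "1 / real (Suc N) < \<bar>?w \<bullet> q i\<bar>"
        using nat_approx_posE by blast
      then have "?w \<in> K i N"
        using w(1) E(1) \<open>w \<noteq> 0\<close> by (auto simp: K_def subspace_scale)
      moreover have "G *v ?w = 0" using w(2) by (simp add: matrix_vector_mult_scaleR)
      ultimately show False using G i by (auto simp: A_def)
    qed
  qed
qed


section \<open>The estimator for a fixed response\<close>

lemma inner_transpose_mult_vec:
  fixes A :: "real ^ 'n ^ 'm"
  shows "(transpose A *v a) \<bullet> b = a \<bullet> (A *v b)"
  by (metis dot_lmul_matrix transpose_matrix_vector)

lemma matrix_inv_right_inverse: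
  assumes "invertible A"
  shows "A ** matrix_inv A = mat 1"
  using assms someI_ex[of "\<lambda>A'. A ** A' = mat 1 \<and> A' ** A = mat 1"]
  unfolding invertible_def matrix_inv_def by blast

text \<open>Here w is, up to the factor r, the solution of the normal equations with right-hand side
  X^T u. Since the sketched Gram matrix is symmetric, its inverse can be moved from X^T y onto m,
  which leaves the inner product of w and y. The factor 1 / k in the Gram matrix cancels the
  denominator of \<gamma>.\<close>

lemma inner_partial_sketch_estimator:
  fixes X :: "real ^ 'p ^ 'n" and G :: "real ^ 'n ^ 'k"
  assumes X: "inj ((*v) X)"
    and G: "\<And>v. v \<in> range ((*v) X) \<Longrightarrow> G *v v = 0 \<Longrightarrow> v = 0"
    and w: "w \<in> range ((*v) X)" "\<And>v. v \<in> range ((*v) X) \<Longrightarrow> (G *v w) \<bullet> (G *v v) = r * (u \<bullet> v)"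
    and r: "r \<noteq> 0" and m: "m = \<alpha> *\<^sub>R (transpose X *v u)"
  shows "m \<bullet> partial_sketch_estimator (sqrt (1 / real CARD('k)) *\<^sub>R G) X y =
    (real CARD('k) - real CARD('p) - 1) / r * (\<alpha> * (w \<bullet> y))"
proof -
  let ?k = "real CARD('k)"
  let ?s = "sqrt (1 / ?k)"
  define A where "A = (?s *\<^sub>R G) ** X"
  define B where "B = transpose A ** A"
  have s: "?s * ?s = 1 / ?k" "?s \<noteq> 0" by simp_all
  have Av: "A *v v = ?s *\<^sub>R (G *v (X *v v))" for v
    by (simp add: A_def scaleR_matrix_vector_assoc flip: matrix_vector_mul_assoc)
  have Bv: "(B *v v) \<bullet> v' = (1 / ?k) * ((G *v (X *v v)) \<bullet> (G *v (X *v v')))" for v v'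
    using s by (simp add: B_def Av inner_transpose_mult_vec del: transpose_matrix_vector
        flip: matrix_vector_mul_assoc mult.assoc)
  have "v = 0" if "B *v v = 0" for v
  proof -
    have "(G *v (X *v v)) \<bullet> (G *v (X *v v)) = 0" using Bv[of v v] that by simp
    then have "X *v v = 0" using G[of "X *v v"] by simp
    then show ?thesis using injD[OF X, of v 0] by simp
  qed
  then have "invertible B"
    unfolding invertible_left_inverse matrix_left_invertible_ker by blast
  then have Binv: "B *v (matrix_inv B *v z) = z" for z
    by (simp add: matrix_vector_mul_assoc matrix_inv_right_inverse)
  obtain c where c: "w = X *v c" using w(1) by auto
  have Bc: "B *v c = (r / ?k) *\<^sub>R (transpose X *v u)"
  proof (rule vector_eq_ldot[THEN iffD1], intro allI)
    fix v
    have "v \<bullet> (B *v c) = (1 / ?k) * ((G *v w) \<bullet> (G *v (X *v v)))"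
      using Bv[of c v] by (simp add: c inner_commute)
    also have "\<dots> = (r / ?k) * (u \<bullet> (X *v v))"
      using w(2)[of "X *v v"] by simp
    finally show "v \<bullet> (B *v c) = v \<bullet> ((r / ?k) *\<^sub>R (transpose X *v u))"
      by (simp add: inner_transpose_mult_vec inner_commute[of v] del: transpose_matrix_vector)
  qed
  have sym: "(B *v a) \<bullet> b = a \<bullet> (B *v b)" for a b
    using Bv[of a b] Bv[of b a] by (simp add: inner_commute)
  have "(transpose X *v u) = (?k / r) *\<^sub>R (B *v c)"
    using r by (simp add: Bc del: transpose_matrix_vector)
  then have "m \<bullet> (matrix_inv B *v (transpose X *v y)) = \<alpha> * (?k / r) * (c \<bullet> (transpose X *v y))"
    by (simp add: m sym Binv del: transpose_matrix_vector)
  also have "c \<bullet> (transpose X *v y) = w \<bullet> y"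
    by (simp add: c inner_commute[of c] inner_transpose_mult_vec inner_commute[of y] del: transpose_matrix_vector)
  finally show ?thesis
    by (simp add: partial_sketch_estimator_def Let_def A_def[symmetric] B_def[symmetric] del: transpose_matrix_vector)
qed

text \<open>The residual \<open>n\<close> of g1, after W and \<open>q d\<close> are projected out,
  is orthogonal to W and to g2, hence to the image of every vector of E orthogonal to u1. So a
  preimage of \<open>n\<close> in E solves the normal equations for u1, with r = n.g1 = |n|^2 = R.
  The constant \<open>c\<close> is the coordinate of g2 along \<open>q d\<close>.\<close>

lemma inner_partial_sketch_estimator_resample:
  fixes X :: "real ^ 'p ^ 'n" and G :: "real ^ 'n ^ 'k"
  defines "E \<equiv> range ((*v) X)"
  assumes X: "inj ((*v) X)"
    and u1: "u1 \<in> E" "norm u1 = 1" and u2: "u2 \<in> E" "norm u2 = 1" and u12: "u1 \<bullet> u2 = 0"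
    and m: "m = \<alpha> *\<^sub>R (transpose X *v u1)"
    and y: "\<And>w. w \<in> E \<Longrightarrow> u1 \<bullet> w = 0 \<Longrightarrow> u2 \<bullet> w = 0 \<Longrightarrow> w \<bullet> y = 0"
    and G: "\<And>v. v \<in> E \<Longrightarrow> G *v v = 0 \<Longrightarrow> v = 0"
    and W: "W = (*v) G ` {w \<in> E. u1 \<bullet> w = 0 \<and> u2 \<bullet> w = 0}"
    and q: "orthonormal_on {..<Suc d} q" "\<And>i w. i < Suc d \<Longrightarrow> w \<in> W \<Longrightarrow> orthogonal w (q i)"
    and expand: "\<And>x. (\<And>w. w \<in> W \<Longrightarrow> orthogonal w x) \<Longrightarrow> (\<Sum>i<Suc d. (x \<bullet> q i) *\<^sub>R q i) = x"
    and g2: "g2 - c *\<^sub>R q d \<in> W" "c \<noteq> 0"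
    and R: "(\<Sum>i<d. (g1 \<bullet> q i)\<^sup>2) \<noteq> 0"
  shows "m \<bullet> partial_sketch_estimator (sqrt (1 / real CARD('k)) *\<^sub>R resample u1 (resample u2 G g2) g1) X y =
    (real CARD('k) - real CARD('p) - 1) / (\<Sum>i<d. (g1 \<bullet> q i)\<^sup>2) *
      (\<alpha> * (y \<bullet> u1 - (g1 \<bullet> q d) / c * (y \<bullet> u2)))"
proof -
  let ?G = "resample u1 (resample u2 G g2) g1"
  define T where "T = g1 \<bullet> q d"
  define n where "n = (\<Sum>i<d. (g1 \<bullet> q i) *\<^sub>R q i)"
  define R where "R = (\<Sum>i<d. (g1 \<bullet> q i)\<^sup>2)"
  let ?E = "{w \<in> E. u1 \<bullet> w = 0 \<and> u2 \<bullet> w = 0}"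
  have subE: "subspace E" unfolding E_def by (intro linear_subspace_image) auto
  have subE': "subspace ?E"
    using subE by (auto simp: subspace_def inner_add_right)
  have subW: "subspace W" unfolding W by (intro linear_subspace_image subE') auto
  have uu: "u1 \<bullet> u1 = 1" "u2 \<bullet> u2 = 1" "u2 \<bullet> u1 = 0"
    using u1 u2 u12 by (simp_all add: norm_eq_1 inner_commute)
  have G'v: "?G *v v = G *v v + (u2 \<bullet> v) *\<^sub>R (g2 - G *v u2) + (u1 \<bullet> v) *\<^sub>R (g1 - G *v u1)" for v
    by (simp add: resample_mult_vec uu)
  have G'u: "?G *v u1 = g1" "?G *v u2 = g2" by (simp_all add: G'v uu u12)
  have G'E: "?G *v v = G *v v" if "v \<in> ?E" for v using that by (simp add: G'v)
  have dec: "\<exists>v'\<in>?E. v = v' + (u1 \<bullet> v) *\<^sub>R u1 + (u2 \<bullet> v) *\<^sub>R u2" if "v \<in> E" for v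
    by (rule bexI[of _ "v - (u1 \<bullet> v) *\<^sub>R u1 - (u2 \<bullet> v) *\<^sub>R u2"])
      (use that u1 u2 subE uu u12 in \<open>auto simp: subspace_diff subspace_scale inner_diff_right\<close>)
  have nq: "n \<bullet> q d = 0"
    using q(1) by (simp add: n_def inner_sum_left orthonormal_on_def)
  have nW: "n \<bullet> x = 0" if "x \<in> W" for x
  proof -
    have "q i \<bullet> x = 0" if "i < d" for i
      using q(2)[of i x] that \<open>x \<in> W\<close> by (simp add: orthogonal_def inner_commute[of x])
    then show ?thesis by (simp add: n_def inner_sum_left)
  qed
  have ng1: "n \<bullet> g1 = R"
    unfolding n_def R_def inner_sum_left by (simp add: power2_eq_square inner_commute[of _ g1])
  have ng2: "n \<bullet> g2 = 0"
    using nW[OF g2(1)] nq by (simp add: inner_diff_right)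
  have qd: "q d \<bullet> q d = 1" "x \<in> W \<Longrightarrow> q d \<bullet> x = 0" for x
    using q by (auto simp: orthonormal_on_def orthogonal_def inner_commute)
  have qdg2: "q d \<bullet> g2 = c"
    using qd(2)[OF g2(1)] qd(1) by (simp add: inner_diff_right)
  have "g1 - (\<Sum>i\<in>{..<Suc d}. (g1 \<bullet> q i) *\<^sub>R q i) \<in> W"
    by (rule diff_orthogonal_expansion_in_subspace[OF subW]) (use expand q(2) in auto)
  then obtain w1 where w1: "w1 \<in> ?E" "g1 = n + T *\<^sub>R q d + G *v w1"
    unfolding W by (auto simp: n_def T_def algebra_simps)
  obtain w2 where w2: "w2 \<in> ?E" "g2 = c *\<^sub>R q d + G *v w2"
    using g2(1) unfolding W by (auto simp: algebra_simps)
  \<comment> \<open>Read off from \<open>n\<close> = g1 - G w1 - T \<open>q d\<close> and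
    \<open>q d\<close> = (g2 - G w2) / c, since the resampled matrix sends u1 to g1, u2 to g2 and
    agrees with G on w1 and w2.\<close>
  define w where "w = u1 - w1 - (T / c) *\<^sub>R (u2 - w2)"
  have wE: "w \<in> E"
    using u1 u2 w1 w2 subE by (auto simp: w_def subspace_diff subspace_scale)
  have "?G *v w = g1 - G *v w1 - (T / c) *\<^sub>R (g2 - G *v w2)"
    using w1(1) w2(1) by (simp add: w_def matrix_vector_mult_diff_distrib matrix_vector_mult_scaleR G'u G'E)
  also have "\<dots> = n" using g2(2) by (simp add: w1(2) w2(2))
  finally have Gw: "?G *v w = n" .
  have normal: "n \<bullet> (?G *v v) = R * (u1 \<bullet> v)" if v: "v \<in> E" for v
  proof -
    obtain v' where v': "v' \<in> ?E" "v = v' + (u1 \<bullet> v) *\<^sub>R u1 + (u2 \<bullet> v) *\<^sub>R u2"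
      using dec[OF v] by blast
    have "?G *v v = G *v v' + (u1 \<bullet> v) *\<^sub>R g1 + (u2 \<bullet> v) *\<^sub>R g2"
      by (subst v'(2)) (simp add: matrix_vector_right_distrib matrix_vector_mult_scaleR G'u G'E[OF v'(1)])
    moreover have "n \<bullet> (G *v v') = 0" using nW v'(1) W by blast
    ultimately show ?thesis by (simp add: inner_add_right ng1 ng2)
  qed
  \<comment> \<open>Pairing the image of v with \<open>n\<close> kills the u1-coordinate of v,
    pairing it with \<open>q d\<close> then kills the u2-coordinate, and on what remains the matrix
    is G.\<close>
  have G'inj: "v = 0" if v: "v \<in> E" "?G *v v = 0" for v
  proof -
    have 1: "u1 \<bullet> v = 0" using normal[OF v(1)] v(2) R by (simp add: R_def)
    obtain v' where v': "v' \<in> ?E" "v = v' + (u1 \<bullet> v) *\<^sub>R u1 + (u2 \<bullet> v) *\<^sub>R u2"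
      using dec[OF v(1)] by blast
    have 2: "?G *v v = G *v v' + (u2 \<bullet> v) *\<^sub>R g2"
      by (subst v'(2)) (simp add: 1 matrix_vector_right_distrib matrix_vector_mult_scaleR G'u G'E[OF v'(1)])
    have "q d \<bullet> (G *v v') = 0" using qd(2) v'(1) W by blast
    then have "(u2 \<bullet> v) * c = 0"
      using arg_cong[OF 2, of "\<lambda>x. q d \<bullet> x"] v(2) by (simp add: inner_add_right qdg2)
    then have "u2 \<bullet> v = 0" using g2(2) by simp
    then show ?thesis using 2 v v' 1 G[of v'] by simp
  qed
  \<comment> \<open>Only u1 and u2 contribute: w1 and w2 lie in the complement of u1 and u2 in E,
    which is orthogonal to y by hypothesis.\<close>
  have wy: "w \<bullet> y = y \<bullet> u1 - T / c * (y \<bullet> u2)"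
    using y[of w1] y[of w2] w1(1) w2(1) by (simp add: w_def inner_diff_left inner_commute[of y])
  show ?thesis
    using inner_partial_sketch_estimator[OF X, of ?G w R u1 m \<alpha> y] G'inj normal wE Gw R m
    by (simp add: E_def R_def wy T_def)
qed

section \<open>Integrating out the two resampled columns\<close>

lemma AE_std_gaussian_sum_squares_nonzero:
  fixes q :: "nat \<Rightarrow> 'e::euclidean_space"
  assumes q: "orthonormal_on {..<d} q" "0 < d"
  shows "AE x in std_gaussian. (\<Sum>i<d. (x \<bullet> q i)\<^sup>2) \<noteq> 0"
proof -
  have nz: "q 0 \<noteq> 0" using q by (force simp: orthonormal_on_def)
  have "AE x in std_gaussian. x \<notin> {x. q 0 \<bullet> x = 0}"
    by (rule AE_std_gaussian_not_in_subspace)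
      (auto simp: subspace_hyperplane dim_hyperplane[OF nz])
  then show ?thesis
  proof (rule AE_mp, intro AE_I2 impI)
    fix x assume "x \<notin> {x. q 0 \<bullet> x = 0}"
    then have "0 < (x \<bullet> q 0)\<^sup>2" by (simp add: inner_commute)
    also have "\<dots> \<le> (\<Sum>i<d. (x \<bullet> q i)\<^sup>2)" by (rule member_le_sum) (use q(2) in auto)
    finally show "(\<Sum>i<d. (x \<bullet> q i)\<^sup>2) \<noteq> 0" by simp
  qed
qed

text \<open>With G and g2 frozen, \<open>c\<close> and the basis \<open>q\<close> are constants, and
  g1 enters only through its coordinates in that basis: the one along \<open>q d\<close> is T, and
  the squares of the other \<open>d\<close> add up to R.\<close>

lemma nn_integral_estimator_resample_column:
  fixes X :: "real ^ 'p ^ 'n" and G :: "real ^ 'n ^ 'k"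
  defines "E \<equiv> range ((*v) X)"
  assumes X: "inj ((*v) X)"
    and u1: "u1 \<in> E" "norm u1 = 1" and u2: "u2 \<in> E" "norm u2 = 1" and u12: "u1 \<bullet> u2 = 0"
    and m: "m = \<alpha> *\<^sub>R (transpose X *v u1)"
    and y: "\<And>w. w \<in> E \<Longrightarrow> u1 \<bullet> w = 0 \<Longrightarrow> u2 \<bullet> w = 0 \<Longrightarrow> w \<bullet> y = 0"
    and G: "\<And>v. v \<in> E \<Longrightarrow> G *v v = 0 \<Longrightarrow> v = 0"
    and W: "W = (*v) G ` {w \<in> E. u1 \<bullet> w = 0 \<and> u2 \<bullet> w = 0}"
    and q: "orthonormal_on {..<Suc d} q" "\<And>i w. i < Suc d \<Longrightarrow> w \<in> W \<Longrightarrow> orthogonal w (q i)"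
    and expand: "\<And>x. (\<And>w. w \<in> W \<Longrightarrow> orthogonal w x) \<Longrightarrow> (\<Sum>i<Suc d. (x \<bullet> q i) *\<^sub>R q i) = x"
    and g2: "g2 - c *\<^sub>R q d \<in> W" "c \<noteq> 0"
    and d: "0 < d"
    and f[measurable]: "f \<in> borel_measurable borel"
  shows "(\<integral>\<^sup>+g1. f (m \<bullet> partial_sketch_estimator
        (sqrt (1 / real CARD('k)) *\<^sub>R resample u1 (resample u2 G g2) g1) X y) \<partial>std_gaussian) =
    (\<integral>\<^sup>+t. \<integral>\<^sup>+r. f ((real CARD('k) - real CARD('p) - 1) / r *
        (\<alpha> * (y \<bullet> u1 - t / c * (y \<bullet> u2)))) \<partial>chi_square d \<partial>std_normal)"
    (is "?l = (\<integral>\<^sup>+t. \<integral>\<^sup>+r. f (?\<Phi> t r) \<partial>_ \<partial>_)")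
proof -
  interpret C: prob_space "chi_square d" unfolding chi_square_def by (rule prob_space_sq_norm_normal)
  let ?TR = "\<lambda>x. (x \<bullet> q d, \<Sum>i<d. (x \<bullet> q i)\<^sup>2)"
  have [measurable]: "(\<lambda>(t, r). f (?\<Phi> t r)) \<in> borel_measurable (borel \<Otimes>\<^sub>M borel)"
    by measurable
  have TR: "?TR \<in> measurable std_gaussian (borel \<Otimes>\<^sub>M borel)" by measurable
  have law: "distr std_gaussian (borel \<Otimes>\<^sub>M borel) ?TR = std_normal \<Otimes>\<^sub>M chi_square d"
    using std_gaussian_coordinate_sum_squares[OF q(1), of "\<lambda>_. 0"]
    by (simp only: chi_square_def add_0)
  have "AE g1 in std_gaussian. (\<Sum>i<d. (g1 \<bullet> q i)\<^sup>2) \<noteq> 0"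
    by (rule AE_std_gaussian_sum_squares_nonzero[OF orthonormal_on_subset[OF q(1)] d]) auto
  then have "?l = (\<integral>\<^sup>+g1. (case ?TR g1 of (t, r) \<Rightarrow> f (?\<Phi> t r)) \<partial>std_gaussian)"
  proof (intro nn_integral_cong_AE, elim AE_mp, intro AE_I2 impI)
    fix g1 assume R: "(\<Sum>i<d. (g1 \<bullet> q i)\<^sup>2) \<noteq> 0"
    show "f (m \<bullet> partial_sketch_estimator
        (sqrt (1 / real CARD('k)) *\<^sub>R resample u1 (resample u2 G g2) g1) X y) =
        (case ?TR g1 of (t, r) \<Rightarrow> f (?\<Phi> t r))"
      unfolding prod.case
      by (rule arg_cong[where f=f], rule inner_partial_sketch_estimator_resample[OF X u1[unfolded E_def]
          u2[unfolded E_def] u12 m y[unfolded E_def] G[unfolded E_def] W[unfolded E_def] q expand g2 R])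
  qed
  also have "\<dots> = (\<integral>\<^sup>+x. (case x of (t, r) \<Rightarrow> f (?\<Phi> t r)) \<partial>distr std_gaussian (borel \<Otimes>\<^sub>M borel) ?TR)"
    by (rule nn_integral_distr[OF TR, symmetric]) measurable
  also have "\<dots> = (\<integral>\<^sup>+t. \<integral>\<^sup>+r. f (?\<Phi> t r) \<partial>chi_square d \<partial>std_normal)"
    unfolding law by (subst C.nn_integral_fst[symmetric]) (simp_all add: chi_square_def)
  finally show ?thesis .
qed

text \<open>Two bases of the complement of W are in play. The basis \<open>q\<close> depends on G
  alone and gives the law of V; the basis \<open>q'\<close> is adapted to g2 and is used only while
  g2 is fixed. Because the integral over g1 depends on g2 through V alone, the choice of
  \<open>q'\<close> as g2 varies never has to be measurable.\<close>

lemma nn_integral_estimator_resample: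
  fixes X :: "real ^ 'p ^ 'n" and G :: "real ^ 'n ^ 'k"
  defines "E \<equiv> range ((*v) X)"
  assumes X: "inj ((*v) X)"
    and u1: "u1 \<in> E" "norm u1 = 1" and u2: "u2 \<in> E" "norm u2 = 1" and u12: "u1 \<bullet> u2 = 0"
    and m: "m = \<alpha> *\<^sub>R (transpose X *v u1)"
    and y: "\<And>w. w \<in> E \<Longrightarrow> u1 \<bullet> w = 0 \<Longrightarrow> u2 \<bullet> w = 0 \<Longrightarrow> w \<bullet> y = 0"
    and G: "\<And>v. v \<in> E \<Longrightarrow> G *v v = 0 \<Longrightarrow> v = 0"
    and k: "CARD('p) < CARD('k)"
    and d: "d = CARD('k) - CARD('p) + 1"
    and f[measurable]: "f \<in> borel_measurable borel"
  shows "(\<integral>\<^sup>+g2. \<integral>\<^sup>+g1. f (m \<bullet> partial_sketch_estimator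
        (sqrt (1 / real CARD('k)) *\<^sub>R resample u1 (resample u2 G g2) g1) X y) \<partial>std_gaussian \<partial>std_gaussian) =
    (\<integral>\<^sup>+v. \<integral>\<^sup>+t. \<integral>\<^sup>+r. f ((real CARD('k) - real CARD('p) - 1) / r *
        (\<alpha> * (y \<bullet> u1 - t / sqrt v * (y \<bullet> u2)))) \<partial>chi_square d \<partial>std_normal \<partial>chi_square (Suc d))"
    (is "(\<integral>\<^sup>+g2. ?l g2 \<partial>_) = (\<integral>\<^sup>+v. ?H v \<partial>_)")
proof -
  interpret C: prob_space "chi_square d" unfolding chi_square_def by (rule prob_space_sq_norm_normal)
  interpret Nr: prob_space std_normal by (rule prob_space_std_normal)
  have [measurable_cong]: "sets (chi_square n) = sets borel" for n by (simp add: chi_square_def)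
  let ?E = "{w \<in> E. u1 \<bullet> w = 0 \<and> u2 \<bullet> w = 0}"
  let ?W = "(*v) G ` ?E"
  let ?O = "{x \<in> UNIV. \<forall>w\<in>?W. orthogonal w x}"
  have subE: "subspace E" unfolding E_def by (intro linear_subspace_image) auto
  have subE': "subspace ?E" using subE by (auto simp: subspace_def inner_add_right)
  have subW: "subspace ?W" by (intro linear_subspace_image subE') auto
  have subO: "subspace ?O" by (auto simp: subspace_def orthogonal_def inner_add_right)
  have dimE: "dim E = CARD('p)"
    unfolding E_def using X by (subst dim_image_eq) auto
  have u0: "u1 \<noteq> 0" "u2 \<noteq> 0" "u1 \<noteq> u2" using u1 u2 u12 by auto
  have "independent {u1, u2}"
    by (rule pairwise_orthogonal_independent)
      (use u0 u12 in \<open>auto simp: pairwise_def orthogonal_def inner_commute\<close>)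
  then have "dim (span {u1, u2}) = 2"
    using u0 by (simp add: dim_eq_card_independent)
  moreover have "dim {x \<in> E. \<forall>w\<in>span {u1, u2}. orthogonal w x} + dim (span {u1, u2}) = dim E"
    by (rule dim_subspace_orthogonal_to_vectors) (use subE u1 u2 span_minimal[of "{u1, u2}" E] in auto)
  moreover have "{x \<in> E. \<forall>w\<in>span {u1, u2}. orthogonal w x} = ?E"
  proof -
    have "(\<forall>w\<in>span {u1, u2}. orthogonal w x) \<longleftrightarrow> u1 \<bullet> x = 0 \<and> u2 \<bullet> x = 0" for x
      using orthogonal_to_span[of _ "{u1, u2}" x]
      by (auto simp: orthogonal_def inner_commute[of _ x] intro: span_base)
    then show ?thesis by blast
  qed
  ultimately have dimE': "dim ?E + 2 = CARD('p)" using dimE by simp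
  have "dim ?W = dim ?E"
  proof (rule dim_image_eq)
    show "inj_on ((*v) G) (span ?E)"
    proof (rule inj_onI)
      fix a b assume ab: "a \<in> span ?E" "b \<in> span ?E" "G *v a = G *v b"
      then have "a - b \<in> E" using subE' subE by (auto simp: span_eq_iff[THEN iffD2] subspace_diff)
      moreover have "G *v (a - b) = 0" using ab(3) by (simp add: matrix_vector_mult_diff_distrib)
      ultimately show "a = b" using G[of "a - b"] by simp
    qed
  qed auto
  then have dimW: "dim ?W + 2 = CARD('p)" using dimE' by simp
  have "dim ?O + dim ?W = dim (UNIV :: (real ^ 'k) set)"
    by (rule dim_subspace_orthogonal_to_vectors[OF subW]) auto
  \<comment> \<open>W has dimension p - 2, so the complement has dimension k - p + 2, one more than
    \<open>d\<close>: the extra direction is that of the component of g2.\<close>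
  then have dimO: "dim ?O = Suc d" using dimW k d by simp
  obtain q where q: "orthonormal_on {..<Suc d} q" "\<And>i. i < Suc d \<Longrightarrow> q i \<in> ?O"
    "\<And>x. x \<in> ?O \<Longrightarrow> (\<Sum>i<Suc d. (x \<bullet> q i) *\<^sub>R q i) = x"
    by (rule orthonormal_basis_family[OF subO, unfolded dimO]) (rule that)
  let ?V = "\<lambda>x. \<Sum>i<Suc d. (x \<bullet> q i)\<^sup>2"
  have "AE g in std_gaussian. g \<notin> ?W"
    by (rule AE_std_gaussian_not_in_subspace[OF subW]) (use dimW k in auto)
  then have "(\<integral>\<^sup>+g2. ?l g2 \<partial>std_gaussian) = (\<integral>\<^sup>+g2. ?H (?V g2) \<partial>std_gaussian)"
  proof (intro nn_integral_cong_AE, elim AE_mp, intro AE_I2 impI)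
    fix g2 assume g2: "g2 \<notin> ?W"
    let ?P = "\<Sum>i<Suc d. (g2 \<bullet> q i) *\<^sub>R q i"
    have P: "g2 - ?P \<in> ?W"
      by (rule diff_orthogonal_expansion_in_subspace[OF subW]) (use q(2,3) in auto)
    have "?P \<bullet> ?P = (\<Sum>i<Suc d. \<Sum>j<Suc d. (g2 \<bullet> q i) * (g2 \<bullet> q j) * (q i \<bullet> q j))"
      unfolding inner_sum_left inner_sum_right by (subst sum.swap) (simp add: mult_ac)
    also have "\<dots> = (\<Sum>i<Suc d. \<Sum>j<Suc d. if j = i then (g2 \<bullet> q i)\<^sup>2 else 0)"
      using q(1) by (intro sum.cong refl) (auto simp: orthonormal_on_def power2_eq_square)
    also have "\<dots> = ?V g2" by (intro sum.cong refl) (simp del: sum.lessThan_Suc)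
    finally have nP: "norm ?P = sqrt (?V g2)" by (simp only: norm_eq_sqrt_inner)
    have "?P \<noteq> 0" using P g2 by auto
    then have V: "sqrt (?V g2) \<noteq> 0" using nP by (metis norm_eq_zero)
    have PO: "?P \<in> ?O" using q(2) by (intro subspace_sum[OF subO] subspace_scale[OF subO]) auto
    \<comment> \<open>The direction of the part of g2 orthogonal to W, nonzero because g2 lies
      outside W. It becomes the last vector of \<open>q'\<close>, and the coordinate of g2 along it
      is \<open>sqrt (?V g2)\<close>.\<close>
    let ?v = "(1 / sqrt (?V g2)) *\<^sub>R ?P"
    have vO: "?v \<in> ?O" by (rule subspace_scale[OF subO PO])
    have "norm ?v = 1" using V nP by (simp del: sum.lessThan_Suc add: sum_nonneg)
    then obtain q' d' where q': "dim ?O = Suc d'" "q' d' = ?v" "orthonormal_on {..<Suc d'} q'"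
      "\<And>i. i < Suc d' \<Longrightarrow> q' i \<in> ?O"
      "\<And>x. x \<in> ?O \<Longrightarrow> (\<Sum>i<Suc d'. (x \<bullet> q' i) *\<^sub>R q' i) = x"
      by (rule orthonormal_basis_family_last[OF subO vO]) (rule that)
    have d': "d' = d" using q'(1) dimO by simp
    have cq: "g2 - sqrt (?V g2) *\<^sub>R q' d \<in> ?W"
      using P V q'(2) by (simp add: d' del: sum.lessThan_Suc)
    have "?l g2 = (\<integral>\<^sup>+t. \<integral>\<^sup>+r. f ((real CARD('k) - real CARD('p) - 1) / r *
        (\<alpha> * (y \<bullet> u1 - t / sqrt (?V g2) * (y \<bullet> u2)))) \<partial>chi_square d \<partial>std_normal)"
      by (rule nn_integral_estimator_resample_column[OF X u1[unfolded E_def] u2[unfolded E_def] u12 m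
          y[unfolded E_def] G[unfolded E_def] refl _ _ _ _ V _ f])
        (use q' d' cq d in \<open>auto simp: E_def\<close>)
    then show "?l g2 = ?H (?V g2)" .
  qed
  also have "\<dots> = (\<integral>\<^sup>+v. ?H v \<partial>distr std_gaussian borel ?V)"
    by (rule nn_integral_distr[symmetric]) measurable
  also have "distr std_gaussian borel ?V = chi_square (Suc d)"
    using std_gaussian_sum_squares[OF q(1), of "\<lambda>_. 0"] by (simp add: chi_square_def)
  finally show ?thesis .
qed


section \<open>Measurability of the estimator\<close>

lemma borel_measurable_det:
  fixes F :: "'a \<Rightarrow> real ^ 'p ^ 'p"
  assumes [measurable]: "\<And>i j. (\<lambda>x. F x $ i $ j) \<in> borel_measurable M"
  shows "(\<lambda>x. det (F x)) \<in> borel_measurable M"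
  unfolding det_def by (intro borel_measurable_sum borel_measurable_times borel_measurable_prod) measurable

text \<open>On singular matrices the choice operator in the definition of the inverse ranges over an
  unsatisfiable predicate, hence always returns the same matrix.\<close>

lemma inner_matrix_inv_mult_vec:
  fixes B :: "real ^ 'p ^ 'p"
  shows "m \<bullet> (matrix_inv B *v z) =
    (if det B \<noteq> 0 then m \<bullet> (\<chi> k. det (\<chi> i j. if j = k then z $ i else B $ i $ j) / det B)
     else m \<bullet> (matrix_inv 0 *v z))"
proof (cases "det B \<noteq> 0")
  case True
  then have "B *v (matrix_inv B *v z) = z"
    by (simp add: matrix_vector_mul_assoc matrix_inv_right_inverse invertible_det_nz)
  then show ?thesis using True cramer[OF True] by simp
next
  case False
  have nB: "\<not> (B ** A' = mat 1 \<and> A' ** B = mat 1)" for A'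
    using False invertible_det_nz[of B] unfolding invertible_def by blast
  have n0: "\<not> ((0 :: real ^ 'p ^ 'p) ** A' = mat 1 \<and> A' ** (0 :: real ^ 'p ^ 'p) = mat 1)" for A'
  proof -
    have "mat 0 = (0 :: real ^ 'p ^ 'p)" by (simp add: mat_def vec_eq_iff)
    then have "det (0 :: real ^ 'p ^ 'p) = 0" using det_0 by metis
    then show ?thesis
      using invertible_det_nz[of "0 :: real ^ 'p ^ 'p"] unfolding invertible_def by blast
  qed
  have "matrix_inv B = matrix_inv 0" unfolding matrix_inv_def by (simp only: nB n0)
  then show ?thesis using False by simp
qed

text \<open>Cramer's rule turns the solution into quotients of determinants, which are polynomials
  in the entries. On the measurable set where the determinant vanishes the inverse is a fixed
  matrix.\<close>

lemma borel_measurable_inner_partial_sketch_estimator: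
  fixes X :: "real ^ 'p ^ 'n"
  assumes [measurable]: "S \<in> borel_measurable M" "y \<in> borel_measurable M"
  shows "(\<lambda>x. m \<bullet> partial_sketch_estimator (S x :: real ^ 'n ^ 'k) X (y x)) \<in> borel_measurable M"
proof -
  have Sij[measurable]: "(\<lambda>x. S x $ i $ j) \<in> borel_measurable M" for i j
    by (rule measurable_compose[OF assms(1)]) (intro borel_measurable_continuous_onI continuous_intros)
  have yi[measurable]: "(\<lambda>x. y x $ i) \<in> borel_measurable M" for i
    by (rule measurable_compose[OF assms(2)]) (intro borel_measurable_continuous_onI continuous_intros)
  define B where "B x = transpose (S x ** X) ** (S x ** X)" for x
  define z where "z x = transpose X *v y x" for x
  have B[measurable]: "(\<lambda>x. B x $ i $ j) \<in> borel_measurable M" for i j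
    unfolding B_def matrix_matrix_mult_def transpose_def by simp
  have z[measurable]: "(\<lambda>x. z x $ i) \<in> borel_measurable M" for i
    unfolding z_def matrix_vector_mult_def by simp
  have [measurable]: "(\<lambda>x. det (B x)) \<in> borel_measurable M"
    "(\<lambda>x. det (\<chi> i j. if j = k then z x $ i else B x $ i $ j)) \<in> borel_measurable M" for k
    by (rule borel_measurable_det; simp)+
  have "(\<lambda>x. m \<bullet> (matrix_inv (B x) *v z x)) \<in> borel_measurable M"
  proof (subst inner_matrix_inv_mult_vec, rule measurable_If)
    show "{x \<in> space M. det (B x) \<noteq> 0} \<in> sets M" by measurable
  qed (simp_all add: inner_vec_def matrix_vector_mult_def)
  then show ?thesis
    by (simp add: partial_sketch_estimator_def Let_def B_def z_def)
qed

section \<open>Independence and product measures\<close>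

lemma distr_pair_indep_random_elements:
  fixes A :: "'a \<Rightarrow> 'b::second_countable_topology" and B :: "'a \<Rightarrow> 'c::second_countable_topology"
  assumes M: "prob_space M" and AB: "indep_random_elements M A B"
  shows "distr M (borel \<Otimes>\<^sub>M borel) (\<lambda>\<omega>. (A \<omega>, B \<omega>)) = distr M borel A \<Otimes>\<^sub>M distr M borel B"
proof -
  interpret prob_space M by fact
  have [measurable]: "A \<in> borel_measurable M" "B \<in> borel_measurable M"
    using AB by (auto simp: indep_random_elements_def)
  show ?thesis
  proof (rule pair_measure_eqI[symmetric])
    fix P Q assume "P \<in> sets (distr M borel A)" "Q \<in> sets (distr M borel B)"
    then have [measurable]: "P \<in> sets borel" "Q \<in> sets borel" by auto
    have "prob ((A -` P \<inter> space M) \<inter> (B -` Q \<inter> space M)) = prob (A -` P \<inter> space M) * prob (B -` Q \<inter> space M)"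
      using AB unfolding indep_random_elements_def by (intro indep_setD[of "_" "_"]) auto
    moreover have "(\<lambda>\<omega>. (A \<omega>, B \<omega>)) -` (P \<times> Q) \<inter> space M = (A -` P \<inter> space M) \<inter> (B -` Q \<inter> space M)"
      by auto
    ultimately show "emeasure (distr M borel A) P * emeasure (distr M borel B) Q =
        emeasure (distr M (borel \<Otimes>\<^sub>M borel) (\<lambda>\<omega>. (A \<omega>, B \<omega>))) (P \<times> Q)"
      by (simp add: emeasure_distr emeasure_eq_measure ennreal_mult)
  qed (auto intro!: prob_space_imp_sigma_finite prob_space_distr)
qed

text \<open>The components of the product are stored in the order U, V, R, Z of the nested
  integrals, while the theorem lists R, Z, U, V; hence the permuted list of projections.\<close>

lemma indep_vars_pair_measure4:
  fixes A B C D :: "real measure"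
  assumes P: "prob_space A" "prob_space B" "prob_space C" "prob_space D"
    and sets[measurable_cong, simp]: "sets A = sets borel" "sets B = sets borel" "sets C = sets borel" "sets D = sets borel"
  defines "N \<equiv> A \<Otimes>\<^sub>M (B \<Otimes>\<^sub>M (C \<Otimes>\<^sub>M D))"
  shows "prob_space N" "distr N borel fst = A" "distr N borel (\<lambda>\<omega>. fst (snd \<omega>)) = B"
    "distr N borel (\<lambda>\<omega>. fst (snd (snd \<omega>))) = C" "distr N borel (\<lambda>\<omega>. snd (snd (snd \<omega>))) = D"
    "prob_space.indep_vars N (\<lambda>_. borel) (\<lambda>i. [\<lambda>\<omega>. fst (snd (snd \<omega>)), \<lambda>\<omega>. snd (snd (snd \<omega>)),
       fst, \<lambda>\<omega>. fst (snd \<omega>)] ! i) {..<4}"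
proof -
  interpret A: prob_space A by fact
  interpret B: prob_space B by fact
  interpret C: prob_space C by fact
  interpret D: prob_space D by fact
  have pCD: "prob_space (C \<Otimes>\<^sub>M D)" by (intro prob_space_pair P)
  interpret CD: prob_space "C \<Otimes>\<^sub>M D" by fact
  have pBCD: "prob_space (B \<Otimes>\<^sub>M (C \<Otimes>\<^sub>M D))" by (intro prob_space_pair P)
  interpret BCD: prob_space "B \<Otimes>\<^sub>M (C \<Otimes>\<^sub>M D)" by fact
  show pN: "prob_space N" unfolding N_def by (intro prob_space_pair P)
  interpret N: prob_space N by fact
  have [measurable_cong]: "sets N = sets (borel \<Otimes>\<^sub>M (borel \<Otimes>\<^sub>M (borel \<Otimes>\<^sub>M borel)))"
    unfolding N_def by (intro sets_pair_measure_cong sets)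
  have sp: "space A = UNIV" "space B = UNIV" "space C = UNIV" "space D = UNIV"
    using sets_eq_imp_space_eq[OF sets(1)] sets_eq_imp_space_eq[OF sets(2)]
      sets_eq_imp_space_eq[OF sets(3)] sets_eq_imp_space_eq[OF sets(4)] by simp_all
  have box: "emeasure N {\<omega>. fst \<omega> \<in> P \<and> fst (snd \<omega>) \<in> Q \<and> fst (snd (snd \<omega>)) \<in> S \<and> snd (snd (snd \<omega>)) \<in> T} =
      emeasure A P * (emeasure B Q * (emeasure C S * emeasure D T))"
    if [measurable]: "P \<in> sets borel" "Q \<in> sets borel" "S \<in> sets borel" "T \<in> sets borel" for P Q S T
  proof -
    have "{\<omega>. fst \<omega> \<in> P \<and> fst (snd \<omega>) \<in> Q \<and> fst (snd (snd \<omega>)) \<in> S \<and> snd (snd (snd \<omega>)) \<in> T} = P \<times> (Q \<times> (S \<times> T))"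
      by auto
    then show ?thesis
      unfolding N_def
      by (simp add: BCD.emeasure_pair_measure_Times CD.emeasure_pair_measure_Times D.emeasure_pair_measure_Times)
  qed
  have 1: "emeasure A UNIV = 1" "emeasure B UNIV = 1" "emeasure C UNIV = 1" "emeasure D UNIV = 1"
    using A.emeasure_space_1 B.emeasure_space_1 C.emeasure_space_1 D.emeasure_space_1 by (simp_all add: sp)
  have spN: "space N = UNIV" by (simp add: N_def space_pair_measure sp)
  show d: "distr N borel fst = A" "distr N borel (\<lambda>\<omega>. fst (snd \<omega>)) = B"
    "distr N borel (\<lambda>\<omega>. fst (snd (snd \<omega>))) = C" "distr N borel (\<lambda>\<omega>. snd (snd (snd \<omega>))) = D"
    using box[of _ UNIV UNIV UNIV] box[of UNIV _ UNIV UNIV] box[of UNIV UNIV _ UNIV] box[of UNIV UNIV UNIV _]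
    by (auto intro!: measure_eqI simp: emeasure_distr spN vimage_def 1)
  let ?X = "\<lambda>i::nat. [\<lambda>\<omega>. fst (snd (snd \<omega>)), \<lambda>\<omega>. snd (snd (snd \<omega>)), fst, \<lambda>\<omega>. fst (snd \<omega>)] ! i"
  have I: "{..<4::nat} = {0, 1, 2, 3}" by auto
  have rv: "?X i \<in> borel_measurable N" if "i \<in> {..<4}" for i
    using that by (auto simp: I)
  \<comment> \<open>The laws in the order of the list rather than of the product. Indices above 3
    also receive a probability measure, so that \<open>L\<close> is a product family over all of
    nat.\<close>
  define L where "L i = (if i = 0 then C else if i = 1 then D else if i = 2 then A else B)" for i :: nat
  have L: "L i = distr N borel (?X i)" if "i \<in> {..<4}" for i
    using that by (auto simp: I L_def d)
  have "distr N (\<Pi>\<^sub>M i\<in>{..<4}. borel) (\<lambda>x. \<lambda>i\<in>{..<4}. ?X i x) = (\<Pi>\<^sub>M i\<in>{..<4}. L i)"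
  proof -
    interpret L: product_prob_space L
      by (rule product_prob_spaceI) (simp add: L_def P)
    have m: "(\<lambda>x. \<lambda>i\<in>{..<4}. ?X i x) \<in> measurable N (\<Pi>\<^sub>M i\<in>{..<4}. borel)"
      by (rule measurable_restrict) (rule rv)
    show ?thesis
    proof (rule L.PiM_eqI)
      show "sets (distr N (\<Pi>\<^sub>M i\<in>{..<4}. borel) (\<lambda>x. \<lambda>i\<in>{..<4}. ?X i x)) = sets (\<Pi>\<^sub>M i\<in>{..<4}. L i)"
        by (simp only: sets_distr) (rule sets_PiM_cong, simp_all add: L_def)
      fix E assume "\<And>i. i \<in> {..<4} \<Longrightarrow> E i \<in> sets (L i)"
      then have E: "i \<in> {..<4} \<Longrightarrow> E i \<in> sets borel" for i by (simp add: L)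
      have "emeasure (distr N (\<Pi>\<^sub>M i\<in>{..<4}. borel) (\<lambda>x. \<lambda>i\<in>{..<4}. ?X i x)) (Pi\<^sub>E {..<4} E)
          = emeasure N ((\<lambda>x. \<lambda>i\<in>{..<4}. ?X i x) -` Pi\<^sub>E {..<4} E \<inter> space N)"
        by (rule emeasure_distr[OF m]) (use E in \<open>auto intro!: sets_PiM_I_finite\<close>)
      also have "(\<lambda>x. \<lambda>i\<in>{..<4}. ?X i x) -` Pi\<^sub>E {..<4} E \<inter> space N =
          {\<omega>. fst \<omega> \<in> E 2 \<and> fst (snd \<omega>) \<in> E 3 \<and> fst (snd (snd \<omega>)) \<in> E 0 \<and> snd (snd (snd \<omega>)) \<in> E 1}"
        by (auto simp: spN PiE_iff I)
      also have "emeasure N \<dots> = emeasure A (E 2) * (emeasure B (E 3) * (emeasure C (E 0) * emeasure D (E 1)))"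
        by (rule box) (simp_all add: E)
      also have "\<dots> = (\<Prod>i\<in>{..<4}. emeasure (L i) (E i))"
        by (simp add: I L_def mult_ac)
      finally show "emeasure (distr N (\<Pi>\<^sub>M i\<in>{..<4}. borel) (\<lambda>x. \<lambda>i\<in>{..<4}. ?X i x)) (Pi\<^sub>E {..<4} E)
          = (\<Prod>i\<in>{..<4}. emeasure (L i) (E i))" .
    qed simp
  qed
  also have "\<dots> = (\<Pi>\<^sub>M i\<in>{..<4}. distr N borel (?X i))"
    by (rule PiM_cong) (simp_all add: L)
  finally have eq: "distr N (\<Pi>\<^sub>M i\<in>{..<4}. borel) (\<lambda>x. \<lambda>i\<in>{..<4}. ?X i x) = (\<Pi>\<^sub>M i\<in>{..<4}. distr N borel (?X i))" .
  have ne: "{..<4::nat} \<noteq> {}" by (simp add: I)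
  show "N.indep_vars (\<lambda>_. borel) ?X {..<4}"
    by (rule N.indep_vars_iff_distr_eq_PiM'[where X="?X" and M'="\<lambda>_. borel", OF ne rv, THEN iffD2, OF _ eq])
qed

section \<open>Integrating out the sketch for a fixed response\<close>

lemma dim_range_mult_vec:
  fixes X :: "real ^ 'p ^ 'n"
  assumes "inj ((*v) X)"
  shows "dim (range ((*v) X)) = CARD('p)"
  using assms by (subst dim_image_eq) auto

text \<open>The vector u2 of the geometric argument depends on the response; only its inner product with
  the response, the last square root below, survives.\<close>

lemma nn_integral_estimator_sketch:
  fixes X :: "real ^ 'p ^ 'n" and e :: "nat \<Rightarrow> real ^ 'n" and y :: "real ^ 'n"
  assumes X: "inj ((*v) X)" and p: "CARD('p) = Suc (Suc p)"
    and e: "orthonormal_on {..<CARD('p)} e" "\<And>i. i < CARD('p) \<Longrightarrow> e i \<in> range ((*v) X)"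
    and expand: "\<And>x. x \<in> range ((*v) X) \<Longrightarrow> (\<Sum>i<CARD('p). (x \<bullet> e i) *\<^sub>R e i) = x"
    and m: "m = \<alpha> *\<^sub>R (transpose X *v e (Suc p))"
    and k: "CARD('p) < CARD('k)" and d: "d = CARD('k) - CARD('p) + 1"
    and f[measurable]: "f \<in> borel_measurable borel"
  shows "(\<integral>\<^sup>+G. f (m \<bullet> partial_sketch_estimator
        (sqrt (1 / real CARD('k)) *\<^sub>R (G :: real ^ 'n ^ 'k)) X y) \<partial>std_gaussian) =
    (\<integral>\<^sup>+v. \<integral>\<^sup>+t. \<integral>\<^sup>+r. f ((real CARD('k) - real CARD('p) - 1) / r *
        (\<alpha> * (y \<bullet> e (Suc p) - t / sqrt v * sqrt (\<Sum>i<Suc p. (y \<bullet> e i)\<^sup>2))))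
       \<partial>chi_square d \<partial>std_normal \<partial>chi_square (Suc d))"
    (is "(\<integral>\<^sup>+G. ?h G \<partial>_) = ?r")
proof -
  interpret K: prob_space "std_gaussian :: (real ^ 'k) measure" by (rule prob_space_std_gaussian)
  interpret KN: prob_space "std_gaussian :: (real ^ 'n ^ 'k) measure" by (rule prob_space_std_gaussian)
  let ?E = "range ((*v) X)"
  note sum.lessThan_Suc[simp del]
  \<comment> \<open>Here p is the dimension of E minus two, so \<open>Suc p\<close> is the last
    index and the indices below it run through the complement of u1 in E.\<close>
  define u1 where "u1 = e (Suc p)"
  define z where "z = (\<Sum>i<Suc p. (y \<bullet> e i) *\<^sub>R e i)"
  \<comment> \<open>When the part z of the response vanishes, any unit vector of E orthogonal to u1
    will do; \<open>e 0\<close> is one since E has dimension at least two. In that case y.u2 is 0,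
    in agreement with the square root.\<close>
  define u2 where "u2 = (if z = 0 then e 0 else (1 / norm z) *\<^sub>R z)"
  have subE: "subspace ?E" by (intro linear_subspace_image) auto
  have ee: "e i \<bullet> e j = (if i = j then 1 else 0)" if "i < Suc (Suc p)" "j < Suc (Suc p)" for i j
    using e(1) that by (simp add: orthonormal_on_def p)
  have zE: "z \<in> ?E"
    unfolding z_def using e(2) p by (intro subspace_sum[OF subE] subspace_scale[OF subE]) auto
  have u1: "u1 \<in> ?E" "norm u1 = 1" using e(2) p ee by (auto simp: u1_def norm_eq_1)
  have u2: "u2 \<in> ?E" "norm u2 = 1"
  proof -
    have "norm (e 0) = 1" using ee[of 0 0] by (simp add: norm_eq_1)
    then show "u2 \<in> ?E" "norm u2 = 1"
      using subspace_scale[OF subE zE, of "1 / norm z"] e(2)[of 0] p by (simp_all add: u2_def)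
  qed
  have u1z: "u1 \<bullet> z = 0"
    by (simp add: z_def u1_def inner_sum_right ee)
  then have u12: "u1 \<bullet> u2 = 0" by (simp add: u2_def u1_def ee)
  have yz: "y \<bullet> z = (\<Sum>i<Suc p. (y \<bullet> e i)\<^sup>2)"
    unfolding z_def inner_sum_right by (simp add: power2_eq_square)
  have "z \<bullet> e j = y \<bullet> e j" if "j < Suc p" for j
  proof -
    have "z \<bullet> e j = (\<Sum>i<Suc p. if i = j then y \<bullet> e j else 0)"
      unfolding z_def inner_sum_left using that by (intro sum.cong refl) (simp add: ee)
    then show ?thesis using that by (simp del: sum.lessThan_Suc)
  qed
  then have "z \<bullet> z = (\<Sum>i<Suc p. (y \<bullet> e i)\<^sup>2)"
    by (subst (2) z_def, unfold inner_sum_right) (simp add: power2_eq_square)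
  then have nz: "norm z = sqrt (\<Sum>i<Suc p. (y \<bullet> e i)\<^sup>2)" and yzn: "y \<bullet> z = norm z * norm z"
    by (simp_all only: norm_eq_sqrt_inner yz) (simp add: sum_nonneg del: sum.lessThan_Suc)
  have z0: "y \<bullet> e 0 = 0" if "z = 0"
  proof -
    have "(\<Sum>i<Suc p. (y \<bullet> e i)\<^sup>2) = 0" using that yz by simp
    then show ?thesis by (subst (asm) sum_nonneg_eq_0_iff) auto
  qed
  have yu2: "y \<bullet> u2 = sqrt (\<Sum>i<Suc p. (y \<bullet> e i)\<^sup>2)"
    using z0 yzn by (auto simp: u2_def nz[symmetric] simp del: sum.lessThan_Suc)
  have yw: "w \<bullet> y = 0" if w: "w \<in> ?E" "u1 \<bullet> w = 0" "u2 \<bullet> w = 0" for w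
  proof -
    have "w \<bullet> y = (\<Sum>i<CARD('p). (w \<bullet> e i) *\<^sub>R e i) \<bullet> y" using expand[OF w(1)] by simp
    also have "\<dots> = (\<Sum>i<Suc (Suc p). (w \<bullet> e i) * (e i \<bullet> y))"
      by (simp add: inner_sum_left p)
    also have "\<dots> = (\<Sum>i<Suc p. (w \<bullet> e i) * (e i \<bullet> y))"
      using w(2) by (simp add: u1_def inner_commute sum.lessThan_Suc[of _ "Suc p"])
    also have "\<dots> = w \<bullet> z"
      unfolding z_def inner_sum_right by (intro sum.cong refl) (simp add: inner_commute)
    also have "\<dots> = 0" using w(3) by (cases "z = 0") (auto simp: u2_def inner_commute)
    finally show ?thesis .
  qed
  have h[measurable]: "?h \<in> borel_measurable borel"
    by (rule measurable_compose[OF borel_measurable_inner_partial_sketch_estimator f]) auto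
  have hr: "(\<lambda>(G, g). ?h (resample u G g)) \<in> borel_measurable (borel \<Otimes>\<^sub>M borel)" for u
    using measurable_compose[OF borel_measurable_resample[of u] h] by (simp add: borel_prod split_beta)
  have h1: "(\<lambda>G. \<integral>\<^sup>+g1. ?h (resample u1 G g1) \<partial>std_gaussian) \<in> borel_measurable borel"
    by (rule K.borel_measurable_nn_integral) (use hr[of u1] in \<open>simp cong: measurable_cong_sets\<close>)
  have "(\<integral>\<^sup>+G. ?h G \<partial>std_gaussian) = (\<integral>\<^sup>+G. \<integral>\<^sup>+g1. ?h (resample u1 G g1) \<partial>std_gaussian \<partial>std_gaussian)"
    by (rule nn_integral_std_gaussian_resample[OF u1(2) h])
  \<comment> \<open>The lemma is applied to the integrand already averaged over g1. As u1 and u2 are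
    orthogonal, the outer replacement at u1 leaves the new value g2 at u2 intact.\<close>
  also have "\<dots> = (\<integral>\<^sup>+G. \<integral>\<^sup>+g2. \<integral>\<^sup>+g1. ?h (resample u1 (resample u2 G g2) g1) \<partial>std_gaussian \<partial>std_gaussian \<partial>std_gaussian)"
    by (rule nn_integral_std_gaussian_resample[OF u2(2) h1])
  also have "\<dots> = (\<integral>\<^sup>+(G :: real ^ 'n ^ 'k). ?r \<partial>std_gaussian)"
  proof (rule nn_integral_cong_AE)
    have "AE G in (std_gaussian :: (real ^ 'n ^ 'k) measure). \<forall>w\<in>?E. G *v w = 0 \<longrightarrow> w = 0"
      by (rule AE_std_gaussian_inj_on_subspace[OF subE]) (use k dim_range_mult_vec[OF X] in simp)
    then show "AE G in std_gaussian. (\<integral>\<^sup>+g2. \<integral>\<^sup>+g1. ?h (resample u1 (resample u2 G g2) g1) \<partial>std_gaussian \<partial>std_gaussian) = ?r"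
    proof (rule AE_mp, intro AE_I2 impI)
      fix G :: "real ^ 'n ^ 'k" assume G: "\<forall>w\<in>?E. G *v w = 0 \<longrightarrow> w = 0"
      show "(\<integral>\<^sup>+g2. \<integral>\<^sup>+g1. ?h (resample u1 (resample u2 G g2) g1) \<partial>std_gaussian \<partial>std_gaussian) = ?r"
        using nn_integral_estimator_resample[OF X u1 u2 u12 m[folded u1_def] yw _ k d f] G
        unfolding yu2[symmetric] u1_def[symmetric] by blast
    qed
  qed
  also have "\<dots> = ?r" by (simp add: KN.emeasure_space_1[simplified])
  finally show ?thesis .
qed

lemma nn_integral_prob_swap:
  assumes "prob_space A" "prob_space B" "case_prod g \<in> borel_measurable (A \<Otimes>\<^sub>M B)"
  shows "(\<integral>\<^sup>+a. \<integral>\<^sup>+b. g a b \<partial>B \<partial>A) = (\<integral>\<^sup>+b. \<integral>\<^sup>+a. g a b \<partial>A \<partial>B)"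
proof -
  interpret A: prob_space A by fact
  interpret B: prob_space B by fact
  interpret pair_sigma_finite A B ..
  show ?thesis using Fubini'[OF assms(3)] by simp
qed


section \<open>The joint law\<close>

lemma distr_isotropic_normal:
  fixes y :: "'a \<Rightarrow> real ^ 'n"
  assumes M: "prob_space M" and y: "isotropic_normal M y \<mu> \<sigma>" and \<sigma>: "0 < \<sigma>"
  shows "distr M borel y = distr std_gaussian borel (\<lambda>x. \<mu> + \<sigma> *\<^sub>R x)"
proof (rule distr_eq_std_gaussian[OF M, where I=UNIV and e="\<lambda>i. axis i 1"])
  show "(\<Sum>i\<in>UNIV. (x \<bullet> axis i 1) *\<^sub>R axis i 1) = x" for x :: "real ^ 'n"
  proof -
    have "x \<bullet> axis i 1 = x $ i" for i by (simp add: inner_axis)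
    then have "(\<Sum>i\<in>UNIV. (x \<bullet> axis i 1) *\<^sub>R axis i 1) $ j = (\<Sum>i\<in>UNIV. if i = j then x $ i else 0)" for j
      unfolding sum_component by (intro sum.cong refl) (simp add: axis_def)
    then show ?thesis by (simp add: vec_eq_iff)
  qed
  show "orthonormal_on UNIV (\<lambda>i. axis i 1 :: real ^ 'n)"
    by (auto simp: orthonormal_on_def inner_axis_axis)
qed (use y \<sigma> in \<open>auto simp: isotropic_normal_def inner_axis\<close>)

lemma distr_gaussian_sketching_matrix:
  fixes S :: "'a \<Rightarrow> real ^ 'n ^ 'k"
  assumes M: "prob_space M" and S: "gaussian_sketching_matrix M S"
  shows "distr M borel S = distr std_gaussian borel (\<lambda>G. sqrt (1 / real CARD('k)) *\<^sub>R G)"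
proof -
  let ?e = "\<lambda>(i, j). axis i (axis j 1) :: real ^ 'n ^ 'k"
  have c: "G \<bullet> ?e ij = (case ij of (i, j) \<Rightarrow> G $ i $ j)" for G ij
    by (simp add: inner_axis split: prod.split)
  have "distr M borel S = distr std_gaussian borel (\<lambda>G. 0 + sqrt (1 / real CARD('k)) *\<^sub>R G)"
  proof (rule distr_eq_std_gaussian[OF M, where I=UNIV and e="?e"])
    show "orthonormal_on UNIV ?e"
      by (auto simp: orthonormal_on_def inner_axis_axis)
    show "(\<Sum>ij\<in>UNIV. (G \<bullet> ?e ij) *\<^sub>R ?e ij) = G" for G
    proof -
      have "(\<Sum>ij\<in>UNIV. (G \<bullet> ?e ij) *\<^sub>R ?e ij) = (\<Sum>(i, j)\<in>UNIV \<times> UNIV. G $ i $ j *\<^sub>R axis i (axis j 1))"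
        unfolding c UNIV_Times_UNIV by (intro sum.cong refl) (simp split: prod.split)
      also have "\<dots> = (\<Sum>i\<in>UNIV. \<Sum>j\<in>UNIV. G $ i $ j *\<^sub>R axis i (axis j 1))"
        by (rule sum.cartesian_product[symmetric])
      finally have sum: "(\<Sum>ij\<in>UNIV. (G \<bullet> ?e ij) *\<^sub>R ?e ij) = \<dots>" .
      have "(\<Sum>i\<in>UNIV. \<Sum>j\<in>UNIV. G $ i $ j *\<^sub>R axis i (axis j 1)) $ k $ l =
          (\<Sum>i\<in>UNIV. if i = k then \<Sum>j\<in>UNIV. if j = l then G $ i $ j else 0 else 0)" for k l
      proof -
        have "(G $ i $ j *\<^sub>R (axis i (axis j 1) :: real ^ 'n ^ 'k)) $ k $ l =
            (if i = k then if j = l then G $ i $ j else 0 else 0)" for i j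
          by (simp add: axis_def)
        then show ?thesis
          unfolding sum_component by (intro sum.cong refl) simp
      qed
      then show ?thesis by (simp add: sum vec_eq_iff)
    qed
    have "(\<lambda>ij \<omega>. S \<omega> \<bullet> ?e ij) = (\<lambda>(i, j) \<omega>. S \<omega> $ i $ j)"
      by (simp only: c) (auto simp: fun_eq_iff)
    then show "prob_space.indep_vars M (\<lambda>_. borel) (\<lambda>ij \<omega>. S \<omega> \<bullet> ?e ij) UNIV"
      using S by (simp add: gaussian_sketching_matrix_def)
    show "distributed M lborel (\<lambda>\<omega>. S \<omega> \<bullet> ?e ij) (normal_density (0 \<bullet> ?e ij) (sqrt (1 / real CARD('k))))" for ij
      using S unfolding c by (simp add: gaussian_sketching_matrix_def split: prod.split)
  qed auto
  then show ?thesis by simp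
qed

text \<open>For fixed u, v and r the argument depends on the two normals only through z - sqrt (u /
  v) t. The integrals are exchanged until z and t are innermost, where the two normals merge into
  one.\<close>

lemma nn_integral_combine_normals:
  fixes A U V :: "real measure"
  assumes P: "prob_space A" "prob_space U" "prob_space V"
    and sets[measurable_cong, simp]: "sets A = sets borel" "sets U = sets borel" "sets V = sets borel"
    and nonneg: "AE u in U. 0 \<le> u" "AE v in V. 0 \<le> v"
    and f[measurable]: "f \<in> borel_measurable borel"
  shows "(\<integral>\<^sup>+z. \<integral>\<^sup>+u. \<integral>\<^sup>+v. \<integral>\<^sup>+t. \<integral>\<^sup>+r. f (\<kappa> / r * (\<alpha> * (b + \<sigma> * z - t / sqrt v * (\<sigma> * sqrt u)))) \<partial>A \<partial>std_normal \<partial>V \<partial>U \<partial>std_normal) =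
    (\<integral>\<^sup>+u. \<integral>\<^sup>+v. \<integral>\<^sup>+r. \<integral>\<^sup>+z. f (\<kappa> / r * (\<alpha> * b + \<sigma> * sqrt (1 + u / v) * \<alpha> * z)) \<partial>std_normal \<partial>A \<partial>V \<partial>U)"
    (is "?l = ?r")
proof -
  interpret A: prob_space A by fact
  interpret U: prob_space U by fact
  interpret V: prob_space V by fact
  interpret Z: prob_space std_normal by (rule prob_space_std_normal)
  note Z = prob_space_std_normal
  let ?f = "\<lambda>z u v t r. f (\<kappa> / r * (\<alpha> * (b + \<sigma> * z - t / sqrt v * (\<sigma> * sqrt u))))"
  have "?l = (\<integral>\<^sup>+z. \<integral>\<^sup>+u. \<integral>\<^sup>+v. \<integral>\<^sup>+r. \<integral>\<^sup>+t. ?f z u v t r \<partial>std_normal \<partial>A \<partial>V \<partial>U \<partial>std_normal)"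
    by (intro nn_integral_cong nn_integral_prob_swap[OF Z P(1)]) measurable
  also have "\<dots> = (\<integral>\<^sup>+u. \<integral>\<^sup>+z. \<integral>\<^sup>+v. \<integral>\<^sup>+r. \<integral>\<^sup>+t. ?f z u v t r \<partial>std_normal \<partial>A \<partial>V \<partial>std_normal \<partial>U)"
    by (rule nn_integral_prob_swap[OF Z P(2)]) measurable
  also have "\<dots> = (\<integral>\<^sup>+u. \<integral>\<^sup>+v. \<integral>\<^sup>+z. \<integral>\<^sup>+r. \<integral>\<^sup>+t. ?f z u v t r \<partial>std_normal \<partial>A \<partial>std_normal \<partial>V \<partial>U)"
    by (intro nn_integral_cong nn_integral_prob_swap[OF Z P(3)]) measurable
  also have "\<dots> = (\<integral>\<^sup>+u. \<integral>\<^sup>+v. \<integral>\<^sup>+r. \<integral>\<^sup>+z. \<integral>\<^sup>+t. ?f z u v t r \<partial>std_normal \<partial>std_normal \<partial>A \<partial>V \<partial>U)"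
    by (intro nn_integral_cong nn_integral_prob_swap[OF Z P(1)]) measurable
  also have "\<dots> = ?r"
  \<comment> \<open>Nonnegativity turns the square of \<open>sqrt (u / v)\<close> back into
    \<open>u / v\<close>. The value v = 0 is covered as well, since every quotient by zero is
    0.\<close>
  proof (rule nn_integral_cong_AE, rule AE_mp[OF nonneg(1)], intro AE_I2 impI,
      rule nn_integral_cong_AE, rule AE_mp[OF nonneg(2)], intro AE_I2 impI, rule nn_integral_cong)
    fix u v r :: real assume uv: "0 \<le> u" "0 \<le> v"
    have "(\<integral>\<^sup>+z. \<integral>\<^sup>+t. ?f z u v t r \<partial>std_normal \<partial>std_normal) =
      (\<integral>\<^sup>+z. \<integral>\<^sup>+t. (\<lambda>x. f (\<kappa> / r * (\<alpha> * (b + \<sigma> * x)))) (z - sqrt (u / v) * t) \<partial>std_normal \<partial>std_normal)"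
      by (intro nn_integral_cong arg_cong[where f=f]) (simp add: real_sqrt_divide algebra_simps)
    also have "\<dots> = (\<integral>\<^sup>+z. f (\<kappa> / r * (\<alpha> * (b + \<sigma> * (sqrt (1 + (sqrt (u / v))\<^sup>2) * z)))) \<partial>std_normal)"
      by (rule nn_integral_std_normal_combine) measurable
    also have "\<dots> = (\<integral>\<^sup>+z. f (\<kappa> / r * (\<alpha> * b + \<sigma> * sqrt (1 + u / v) * \<alpha> * z)) \<partial>std_normal)"
      using uv by (intro nn_integral_cong arg_cong[where f=f]) (simp add: algebra_simps)
    finally show "(\<integral>\<^sup>+z. \<integral>\<^sup>+t. ?f z u v t r \<partial>std_normal \<partial>std_normal) =
      (\<integral>\<^sup>+z. f (\<kappa> / r * (\<alpha> * b + \<sigma> * sqrt (1 + u / v) * \<alpha> * z)) \<partial>std_normal)" .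
  qed
  finally show ?thesis .
qed

text \<open>Independence allows the sketch to be integrated first, with y held fixed. The result
  retains only the u1-coordinate of the noise and the sum of squares U, whose joint law is a
  product.\<close>

lemma nn_integral_sketch_estimator:
  fixes M :: "'a measure" and X :: "real ^ 'p ^ 'n" and y :: "'a \<Rightarrow> real ^ 'n" and S :: "'a \<Rightarrow> real ^ 'n ^ 'k"
  assumes M: "prob_space M" and y: "isotropic_normal M y \<nu> \<sigma>" and \<sigma>: "0 < \<sigma>"
    and S: "gaussian_sketching_matrix M S" and Sy: "indep_random_elements M S y"
    and X: "inj ((*v) X)" and p: "CARD('p) = Suc (Suc p)"
    and e: "orthonormal_on {..<CARD('p)} e" "\<And>i. i < CARD('p) \<Longrightarrow> e i \<in> range ((*v) X)"
    and expand: "\<And>x. x \<in> range ((*v) X) \<Longrightarrow> (\<Sum>i<CARD('p). (x \<bullet> e i) *\<^sub>R e i) = x"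
    and m: "m = \<alpha> *\<^sub>R (transpose X *v e (Suc p))"
    and k: "CARD('p) < CARD('k)" and d: "d = CARD('k) - CARD('p) + 1"
    and f[measurable]: "f \<in> borel_measurable borel"
  shows "(\<integral>\<^sup>+\<omega>. f (m \<bullet> partial_sketch_estimator (S \<omega>) X (y \<omega>)) \<partial>M) =
    (\<integral>\<^sup>+u. \<integral>\<^sup>+v. \<integral>\<^sup>+r. \<integral>\<^sup>+z. f ((real CARD('k) - real CARD('p) - 1) / r *
        (\<alpha> * (\<nu> \<bullet> e (Suc p)) + \<sigma> * sqrt (1 + u / v) * \<alpha> * z))
       \<partial>std_normal \<partial>chi_square d \<partial>chi_square (Suc d) \<partial>sq_norm_normal (Suc p) (\<lambda>i. \<nu> \<bullet> e i / \<sigma>))"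
proof -
  interpret prob_space M by fact
  let ?h = "\<lambda>(S :: real ^ 'n ^ 'k, y). f (m \<bullet> partial_sketch_estimator S X y)"
  let ?s = "sqrt (1 / real CARD('k))"
  let ?\<kappa> = "real CARD('k) - real CARD('p) - 1"
  let ?\<mu> = "\<lambda>i. \<nu> \<bullet> e i / \<sigma>"
  have Sm[measurable]: "S \<in> borel_measurable M" and ym[measurable]: "y \<in> borel_measurable M"
    using Sy by (auto simp: indep_random_elements_def)
  interpret DS: prob_space "distr M borel S" by (rule prob_space_distr) measurable
  interpret Dy: prob_space "distr M borel y" by (rule prob_space_distr) measurable
  interpret P: pair_sigma_finite "distr M borel S" "distr M borel y" ..
  interpret G: prob_space "std_gaussian :: (real ^ 'n ^ 'k) measure" by (rule prob_space_std_gaussian)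
  interpret Z: prob_space std_normal by (rule prob_space_std_normal)
  have chi: "prob_space (chi_square n)" for n unfolding chi_square_def by (rule prob_space_sq_norm_normal)
  have chis[measurable_cong, simp]: "sets (chi_square n) = sets borel" for n by (simp add: chi_square_def)
  interpret C1: prob_space "chi_square d" by (rule chi)
  interpret C2: prob_space "chi_square (Suc d)" by (rule chi)
  interpret U: prob_space "sq_norm_normal (Suc p) ?\<mu>" by (rule prob_space_sq_norm_normal)
  have hm[measurable]: "?h \<in> borel_measurable (borel \<Otimes>\<^sub>M borel)"
    unfolding split_beta
    by (rule measurable_compose[OF borel_measurable_inner_partial_sketch_estimator f]) measurable
  let ?J = "\<lambda>(z, u). \<integral>\<^sup>+v. \<integral>\<^sup>+t. \<integral>\<^sup>+r. f (?\<kappa> / r *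
        (\<alpha> * (\<nu> \<bullet> e (Suc p) + \<sigma> * z - t / sqrt v * (\<sigma> * sqrt u)))) \<partial>chi_square d \<partial>std_normal \<partial>chi_square (Suc d)"
  have J[measurable]: "?J \<in> borel_measurable (borel \<Otimes>\<^sub>M borel)" by measurable
  let ?T = "\<lambda>\<epsilon>. (\<epsilon> \<bullet> e (Suc p), \<Sum>i<Suc p. (?\<mu> i + \<epsilon> \<bullet> e i)\<^sup>2)"
  have "(\<integral>\<^sup>+\<omega>. f (m \<bullet> partial_sketch_estimator (S \<omega>) X (y \<omega>)) \<partial>M) =
      (\<integral>\<^sup>+x. ?h x \<partial>distr M (borel \<Otimes>\<^sub>M borel) (\<lambda>\<omega>. (S \<omega>, y \<omega>)))"
    by (subst nn_integral_distr) auto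
  also have "\<dots> = (\<integral>\<^sup>+x. ?h x \<partial>(distr M borel S \<Otimes>\<^sub>M distr M borel y))"
    by (simp only: distr_pair_indep_random_elements[OF M Sy])
  also have "\<dots> = (\<integral>\<^sup>+\<eta>. \<integral>\<^sup>+G. ?h (G, \<eta>) \<partial>distr M borel S \<partial>distr M borel y)"
    by (rule P.nn_integral_snd[symmetric]) measurable
  also have "\<dots> = (\<integral>\<^sup>+\<eta>. \<integral>\<^sup>+G. ?h (?s *\<^sub>R G, \<eta>) \<partial>std_gaussian \<partial>distr std_gaussian borel (\<lambda>x. \<nu> + \<sigma> *\<^sub>R x))"
    unfolding distr_gaussian_sketching_matrix[OF M S] distr_isotropic_normal[OF M y \<sigma>]
    by (intro nn_integral_cong nn_integral_distr) measurable
  also have "\<dots> = (\<integral>\<^sup>+\<epsilon>. \<integral>\<^sup>+G. ?h (?s *\<^sub>R G, \<nu> + \<sigma> *\<^sub>R \<epsilon>) \<partial>std_gaussian \<partial>std_gaussian)"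
    by (rule nn_integral_distr) measurable
  also have "\<dots> = (\<integral>\<^sup>+\<epsilon>. ?J (?T \<epsilon>) \<partial>std_gaussian)"
  proof (rule nn_integral_cong)
    fix \<epsilon> :: "real ^ 'n"
    \<comment> \<open>Pulling \<sigma> out of the square root puts U on the unit-variance scale of a
      noncentral chi-square law; this is why the means are divided by \<sigma>.\<close>
    have "(\<Sum>i<Suc p. ((\<nu> + \<sigma> *\<^sub>R \<epsilon>) \<bullet> e i)\<^sup>2) = (\<Sum>i<Suc p. \<sigma>\<^sup>2 * (?\<mu> i + \<epsilon> \<bullet> e i)\<^sup>2)"
      using \<sigma> by (intro sum.cong refl) (simp add: inner_add_left power_mult_distrib[symmetric] algebra_simps)
    also have "sqrt \<dots> = \<sigma> * sqrt (\<Sum>i<Suc p. (?\<mu> i + \<epsilon> \<bullet> e i)\<^sup>2)"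
      using \<sigma> by (simp only: sum_distrib_left[symmetric] real_sqrt_mult real_sqrt_abs abs_of_pos)
    finally have sq: "sqrt (\<Sum>i<Suc p. ((\<nu> + \<sigma> *\<^sub>R \<epsilon>) \<bullet> e i)\<^sup>2) = \<sigma> * sqrt (\<Sum>i<Suc p. (?\<mu> i + \<epsilon> \<bullet> e i)\<^sup>2)" .
    have "(\<nu> + \<sigma> *\<^sub>R \<epsilon>) \<bullet> e (Suc p) = \<nu> \<bullet> e (Suc p) + \<sigma> * (\<epsilon> \<bullet> e (Suc p))"
      by (simp add: inner_add_left)
    then show "(\<integral>\<^sup>+G. ?h (?s *\<^sub>R G, \<nu> + \<sigma> *\<^sub>R \<epsilon>) \<partial>std_gaussian) = ?J (?T \<epsilon>)"
      unfolding prod.case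
      by (subst nn_integral_estimator_sketch[OF X p e expand m k d f]) (simp_all only: sq)
  qed
  also have "\<dots> = (\<integral>\<^sup>+x. ?J x \<partial>distr std_gaussian (borel \<Otimes>\<^sub>M borel) ?T)"
    by (rule nn_integral_distr[symmetric]) measurable
  also have "\<dots> = (\<integral>\<^sup>+x. ?J x \<partial>(std_normal \<Otimes>\<^sub>M sq_norm_normal (Suc p) ?\<mu>))"
  proof -
    have "distr std_gaussian (borel \<Otimes>\<^sub>M borel) ?T = std_normal \<Otimes>\<^sub>M sq_norm_normal (Suc p) ?\<mu>"
      by (rule std_gaussian_coordinate_sum_squares) (use e(1) p in simp)
    then show ?thesis by (simp only:)
  qed
  also have "\<dots> = (\<integral>\<^sup>+z. \<integral>\<^sup>+u. ?J (z, u) \<partial>sq_norm_normal (Suc p) ?\<mu> \<partial>std_normal)"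
    by (rule U.nn_integral_fst[symmetric]) measurable
  also have "\<dots> = (\<integral>\<^sup>+u. \<integral>\<^sup>+v. \<integral>\<^sup>+r. \<integral>\<^sup>+z. f (?\<kappa> / r *
        (\<alpha> * (\<nu> \<bullet> e (Suc p)) + \<sigma> * sqrt (1 + u / v) * \<alpha> * z))
       \<partial>std_normal \<partial>chi_square d \<partial>chi_square (Suc d) \<partial>sq_norm_normal (Suc p) ?\<mu>)"
    unfolding prod.case
  proof (rule nn_integral_combine_normals)
    show "AE v in chi_square (Suc d). 0 \<le> v"
      unfolding chi_square_def by (rule AE_sq_norm_normal_nonneg)
  qed (simp_all add: chi prob_space_sq_norm_normal AE_sq_norm_normal_nonneg)
  finally show ?thesis .
qed


theorem mainTheorem7:
  fixes M :: "'a measure"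
    and X :: "real ^ 'p ^ 'n"
    and y :: "'a \<Rightarrow> real ^ 'n"
    and S :: "'a \<Rightarrow> real ^ 'n ^ 'k"
    and \<beta>\<^sub>0 m :: "real ^ 'p"
    and \<sigma> :: real
  assumes "prob_space M"
    and "2 \<le> CARD('p)" and "CARD('p) < CARD('n)"
    and "rank X = CARD('p)"
    and "\<beta>\<^sub>0 \<noteq> 0" and "\<sigma> > 0"
    and "isotropic_normal M y (X *v \<beta>\<^sub>0) \<sigma>"
    and "CARD('k) > CARD('p) + 1"
    and "gaussian_sketching_matrix M S"
    and "indep_random_elements M S y"
    and "m \<noteq> 0"
    and "(m \<bullet> \<beta>\<^sub>0) / (norm m * norm \<beta>\<^sub>0) \<noteq> 1"
  shows "\<exists>(N :: (real \<times> real \<times> real \<times> real) measure) R Z U V.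
     prob_space N \<and>
     prob_space.indep_vars N (\<lambda>_. borel) (\<lambda>i. [R, Z, U, V] ! i) {..<4} \<and>
     distr N borel R = chi_square (CARD('k) - CARD('p) + 1) \<and>
     distributed N lborel Z std_normal_density \<and>
     is_noncentral_chi_square (CARD('p) - 1)
       (1 / \<sigma>\<^sup>2 * (\<beta>\<^sub>0 \<bullet> ((transpose X ** X) *v \<beta>\<^sub>0) -
          (m \<bullet> \<beta>\<^sub>0)\<^sup>2 / (m \<bullet> (matrix_inv (transpose X ** X) *v m))))
       (distr N borel U) \<and>
     distr N borel V = chi_square (CARD('k) - CARD('p) + 2) \<and>
     distr M borel (\<lambda>\<omega>. m \<bullet> partial_sketch_estimator (S \<omega>) X (y \<omega>)) =
     distr N borel (\<lambda>\<omega>. (real CARD('k) - real CARD('p) - 1) / R \<omega> *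
       (m \<bullet> \<beta>\<^sub>0 + \<sigma> * sqrt (1 + U \<omega> / V \<omega>) *
          sqrt (m \<bullet> (matrix_inv (transpose X ** X) *v m)) * Z \<omega>))"
proof -
  interpret prob_space M by fact
  \<comment> \<open>Shifted by two, so that \<open>Suc p\<close> is both the number of degrees of
    freedom of U and the index of the last vector in a basis of E.\<close>
  define p where "p = CARD('p) - 2"
  have p: "CARD('p) = Suc (Suc p)" using assms(2) by (simp add: p_def)
  have X: "inj ((*v) X)"
    using assms(4) by (simp add: full_rank_injective[symmetric])
  let ?E = "range ((*v) X)"
  have subE: "subspace ?E" by (intro linear_subspace_image) auto
  define A where "A = transpose X ** X"
  have Av: "A *v c = transpose X *v (X *v c)" for c
    by (simp add: A_def matrix_vector_mul_assoc)
  have "c = 0" if "A *v c = 0" for c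
  proof -
    have "(X *v c) \<bullet> (X *v c) = (transpose X *v (X *v c)) \<bullet> c"
      by (rule inner_transpose_mult_vec[symmetric])
    then have "X *v c = 0" using that by (simp add: Av del: transpose_matrix_vector)
    then show ?thesis using injD[OF X, of c 0] by simp
  qed
  then have "invertible A"
    unfolding invertible_left_inverse matrix_left_invertible_ker by blast
  then have Ainv: "A *v (matrix_inv A *v z) = z" for z
    by (simp add: matrix_vector_mul_assoc matrix_inv_right_inverse)
  define a where "a = X *v (matrix_inv A *v m)"
  define \<alpha> where "\<alpha> = norm a"
  have Xa: "transpose X *v a = m" using Ainv[of m] by (simp only: Av a_def)
  have a0: "a \<noteq> 0" using Xa assms(11) by auto
  then have \<alpha>: "0 < \<alpha>" by (simp add: \<alpha>_def)
  have "m \<bullet> (matrix_inv A *v m) = a \<bullet> a"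
    using inner_transpose_mult_vec[of X a "matrix_inv A *v m"] unfolding Xa by (simp add: a_def)
  then have mAm: "m \<bullet> (matrix_inv A *v m) = \<alpha>\<^sup>2"
    by (simp add: \<alpha>_def power2_norm_eq_inner)
  define u1 where "u1 = (1 / \<alpha>) *\<^sub>R a"
  have u1: "u1 \<in> ?E" "norm u1 = 1"
    using \<alpha> subspace_scale[OF subE, of a "1 / \<alpha>"] by (simp_all add: u1_def a_def \<alpha>_def)
  \<comment> \<open>With u1 placed last, the earlier basis vectors span its complement in E and
    carry U.\<close>
  obtain e d' where e': "dim ?E = Suc d'" "e d' = u1" "orthonormal_on {..<Suc d'} e"
    "\<And>i. i < Suc d' \<Longrightarrow> e i \<in> ?E"
    "\<And>x. x \<in> ?E \<Longrightarrow> (\<Sum>i<Suc d'. (x \<bullet> e i) *\<^sub>R e i) = x"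
    by (rule orthonormal_basis_family_last[OF subE u1]) (rule that)
  have d': "d' = Suc p" using e'(1) dim_range_mult_vec[OF X] p by simp
  have e: "orthonormal_on {..<CARD('p)} e" "\<And>i. i < CARD('p) \<Longrightarrow> e i \<in> ?E"
    "\<And>x. x \<in> ?E \<Longrightarrow> (\<Sum>i<CARD('p). (x \<bullet> e i) *\<^sub>R e i) = x"
    using e' unfolding d' p by auto
  have m: "m = \<alpha> *\<^sub>R (transpose X *v e (Suc p))"
    using \<alpha> e'(2) by (simp add: d' u1_def matrix_vector_mult_scaleR Xa del: transpose_matrix_vector)
  define \<nu> where "\<nu> = X *v \<beta>\<^sub>0"
  have m\<beta>: "\<alpha> * (\<nu> \<bullet> e (Suc p)) = m \<bullet> \<beta>\<^sub>0"
    by (simp add: m \<nu>_def inner_transpose_mult_vec inner_commute[of "X *v \<beta>\<^sub>0"] del: transpose_matrix_vector)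
  let ?\<mu> = "\<lambda>i. \<nu> \<bullet> e i / \<sigma>"
  \<comment> \<open>Parseval in E for the mean \<nu> of the response. Removing the squared
    u1-coordinate leaves the noncentrality; that coordinate is m.beta0 divided by the length
    \<alpha> of a, whose square is the quadratic form in m.\<close>
  have "\<beta>\<^sub>0 \<bullet> (A *v \<beta>\<^sub>0) = \<nu> \<bullet> \<nu>"
    by (simp add: Av \<nu>_def inner_commute[of \<beta>\<^sub>0] inner_transpose_mult_vec del: transpose_matrix_vector)
  also have "\<dots> = (\<Sum>i<CARD('p). (\<nu> \<bullet> e i) *\<^sub>R e i) \<bullet> \<nu>"
    using e(3)[of \<nu>] by (simp add: \<nu>_def)
  also have "\<dots> = (\<Sum>i<Suc p. (\<nu> \<bullet> e i)\<^sup>2) + (\<nu> \<bullet> e (Suc p))\<^sup>2"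
    unfolding inner_sum_left by (simp add: p power2_eq_square inner_commute[of _ \<nu>])
  also have "(\<nu> \<bullet> e (Suc p))\<^sup>2 = (m \<bullet> \<beta>\<^sub>0)\<^sup>2 / \<alpha>\<^sup>2"
    using \<alpha> by (simp add: m\<beta>[symmetric] power_mult_distrib)
  finally have nc: "(\<Sum>i<Suc p. (?\<mu> i)\<^sup>2) =
      1 / \<sigma>\<^sup>2 * (\<beta>\<^sub>0 \<bullet> (A *v \<beta>\<^sub>0) - (m \<bullet> \<beta>\<^sub>0)\<^sup>2 / (m \<bullet> (matrix_inv A *v m)))"
    by (simp only: mAm power_divide sum_divide_distrib[symmetric]) simp
  define d where "d = CARD('k) - CARD('p) + 1"
  have pk: "CARD('p) < CARD('k)" using assms(8) by simp
  have chi: "prob_space (chi_square n)" for n unfolding chi_square_def by (rule prob_space_sq_norm_normal)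
  have chis[measurable_cong, simp]: "sets (chi_square n) = sets borel" for n by (simp add: chi_square_def)
  let ?U = "sq_norm_normal (Suc p) ?\<mu>"
  let ?CZ = "chi_square d \<Otimes>\<^sub>M std_normal"
  let ?VCZ = "chi_square (Suc d) \<Otimes>\<^sub>M ?CZ"
  \<comment> \<open>The nesting U, V, R, Z is that of the iterated integrals in
    \<open>nn_integral_sketch_estimator\<close>, so the integral over \<open>N\<close> unfolds into
    them without exchanging variables.\<close>
  define N where "N = ?U \<Otimes>\<^sub>M ?VCZ"
  interpret U: prob_space ?U by (rule prob_space_sq_norm_normal)
  interpret V: prob_space "chi_square (Suc d)" by (rule chi)
  interpret R: prob_space "chi_square d" by (rule chi)
  interpret Z: prob_space std_normal by (rule prob_space_std_normal)
  interpret CZ: prob_space ?CZ by (intro prob_space_pair chi prob_space_std_normal)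
  interpret VCZ: prob_space ?VCZ by (intro prob_space_pair chi prob_space_std_normal)
  note N = indep_vars_pair_measure4[OF prob_space_sq_norm_normal[of "Suc p" ?\<mu>] chi[of "Suc d"] chi[of d]
      prob_space_std_normal, simplified, folded N_def]
  let ?\<kappa> = "real CARD('k) - real CARD('p) - 1"
  let ?F = "\<lambda>\<omega>. m \<bullet> partial_sketch_estimator (S \<omega>) X (y \<omega>)"
  let ?\<Psi> = "\<lambda>\<omega> :: real \<times> real \<times> real \<times> real. ?\<kappa> / fst (snd (snd \<omega>)) *
       (m \<bullet> \<beta>\<^sub>0 + \<sigma> * sqrt (1 + fst \<omega> / fst (snd \<omega>)) * sqrt (m \<bullet> (matrix_inv A *v m)) * snd (snd (snd \<omega>)))"
  have F[measurable]: "?F \<in> borel_measurable M"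
    using assms(10) by (intro borel_measurable_inner_partial_sketch_estimator) (auto simp: indep_random_elements_def)
  have [measurable_cong]: "sets N = sets (borel \<Otimes>\<^sub>M (borel \<Otimes>\<^sub>M (borel \<Otimes>\<^sub>M borel)))"
    unfolding N_def by (intro sets_pair_measure_cong) simp_all
  have \<Psi>[measurable]: "?\<Psi> \<in> borel_measurable N" by measurable
  have law: "distr M borel ?F = distr N borel ?\<Psi>"
  proof (rule measure_eqI)
    fix B assume "B \<in> sets (distr M borel ?F)"
    then have B[measurable]: "B \<in> sets borel" by simp
    let ?f = "indicator B :: real \<Rightarrow> ennreal"
    have "emeasure (distr M borel ?F) B = (\<integral>\<^sup>+x. ?f x \<partial>distr M borel ?F)" by simp
    also have "\<dots> = (\<integral>\<^sup>+\<omega>. ?f (?F \<omega>) \<partial>M)" by (rule nn_integral_distr) measurable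
    also have "\<dots> = (\<integral>\<^sup>+u. \<integral>\<^sup>+v. \<integral>\<^sup>+r. \<integral>\<^sup>+z. ?f (?\<kappa> / r *
        (\<alpha> * (\<nu> \<bullet> e (Suc p)) + \<sigma> * sqrt (1 + u / v) * \<alpha> * z))
       \<partial>std_normal \<partial>chi_square d \<partial>chi_square (Suc d) \<partial>?U)"
      by (rule nn_integral_sketch_estimator[OF assms(1) assms(7)[folded \<nu>_def] assms(6,9,10) X p e m pk d_def])
        measurable
    also have "\<dots> = (\<integral>\<^sup>+u. \<integral>\<^sup>+v. \<integral>\<^sup>+r. \<integral>\<^sup>+z. ?f (?\<Psi> (u, v, r, z))
       \<partial>std_normal \<partial>chi_square d \<partial>chi_square (Suc d) \<partial>?U)"
      using \<alpha> by (simp add: m\<beta> mAm)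
    also have "\<dots> = (\<integral>\<^sup>+u. \<integral>\<^sup>+v. \<integral>\<^sup>+x. ?f (?\<Psi> (u, v, x)) \<partial>?CZ \<partial>chi_square (Suc d) \<partial>?U)"
      by (intro nn_integral_cong Z.nn_integral_fst) measurable
    also have "\<dots> = (\<integral>\<^sup>+u. \<integral>\<^sup>+x. ?f (?\<Psi> (u, x)) \<partial>?VCZ \<partial>?U)"
      by (intro nn_integral_cong CZ.nn_integral_fst) measurable
    also have "\<dots> = (\<integral>\<^sup>+x. ?f (?\<Psi> x) \<partial>N)"
      unfolding N_def by (rule VCZ.nn_integral_fst) measurable
    also have "\<dots> = (\<integral>\<^sup>+x. ?f x \<partial>distr N borel ?\<Psi>)"
      by (rule nn_integral_distr[symmetric]) measurable
    also have "\<dots> = emeasure (distr N borel ?\<Psi>) B" by simp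
    finally show "emeasure (distr M borel ?F) B = emeasure (distr N borel ?\<Psi>) B" .
  qed simp
  have Zd: "distributed N lborel (\<lambda>\<omega>. snd (snd (snd \<omega>))) std_normal_density"
  proof -
    have "distr N lborel (\<lambda>\<omega>. snd (snd (snd \<omega>))) = distr N borel (\<lambda>\<omega>. snd (snd (snd \<omega>)))"
      by (rule distr_cong) auto
    then show ?thesis using N(5) by (simp add: distributed_def)
  qed
  have "Suc p = CARD('p) - 1" "Suc d = CARD('k) - CARD('p) + 2" by (simp_all add: p d_def)
  then have "is_noncentral_chi_square (CARD('p) - 1)
       (1 / \<sigma>\<^sup>2 * (\<beta>\<^sub>0 \<bullet> (A *v \<beta>\<^sub>0) - (m \<bullet> \<beta>\<^sub>0)\<^sup>2 / (m \<bullet> (matrix_inv A *v m)))) (distr N borel fst)"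
    "distr N borel (\<lambda>\<omega>. fst (snd \<omega>)) = chi_square (CARD('k) - CARD('p) + 2)"
    using nc N(2,3) unfolding is_noncentral_chi_square_def by metis+
  then show ?thesis
    using N(1,4,6) Zd law unfolding A_def[symmetric] d_def by blast
qed


end
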